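(* Let $k\ge1$ and let $b$ be an integer coprime to $d$. Then \[S_k(f,\mathbf d)=\sum_{\bar y\in W_k^{(b)}}F_a(\hat y)F_a(\hat y^q)\cdots F_a(\hat y^{q^{k-1}}),\] where $\hat y$ denotes the coordinatewise Teichmüller lift of $\bar y$.
   Context: Let $p$ prime, $q=p^a$, $f=\sum_u\bar c_ux^u\in\mathbb{F}_q[x_1^{\pm1},\dots,x_n^{\pm1}]$ ($\bar c_u\in\mathbb{F}_q^*$), $\mathbf d=(d_1,\dots,d_n)\in\mathbb{Z}_{\ge1}^n$, $d=\operatorname{lcm}(d_i)$, $N=\sum d_i$. Let $\gamma$ be a root of $\sum_{i\ge0}t^{p^i}/p^i$ with $\operatorname{ord}_p\gamma=1/(p-1)$, $\theta(t)=E(\gamma t)$ with $E$ the Artin–Hasse exponential, $\Theta(\bar z)=\theta(\hat z)$ on $\mathbb{F}_p$, $\psi=\Theta\circ\operatorname{Tr}_{\mathbb{F}_q/\mathbb{F}_p}$, $S_k(f,\mathbf d)=\sum_{x_i\in\mathbb{F}_{q^{kd_i}}^*}\psi(\operatorname{Tr}_{\mathbb{F}_{q^{kd}}/\mathbb{F}_q}f(x_1,\dots,x_n))$. Variables $y_{i,j}$ ($1\le i\le n$, $j\in\mathbb{Z}/d_i\mathbb{Z}$). $W_k^{(b)}$ is the set of $y=(y_{i,j})\in(\overline{\mathbb{F}}_p^* )^N$ with $y_{i,j}^{q^k}=y_{i,(j+b)\bmod d_i}$ for all $i,j$. With $c_u$ the Teichmüller lift of $\bar c_u$ and $\tau$ the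 Frobenius of $\mathbb{Q}_q$ (acting on coefficients), $F(y)=\prod_{l=0}^{d-1}\prod_u\theta(c_u\prod_iy_{i,l\bmod d_i}^{u_i})$ and $F_a(y)=\prod_{m=0}^{a-1}F^{\tau^m}(y^{p^m})$; $\hat y^{q^j}$ raises each coordinate to the $q^j$. *)

theory Defs
  imports
    "HOL-Analysis.Analysis"
    "HOL-Computational_Algebra.Computational_Algebra"
    "HOL-Library.Poly_Mapping"
begin

text \<open>
  There is no ready-made field of \<open>p\<close>-adic numbers to build on, so \<open>\<complex>\<^sub>p\<close> is pinned down
  axiomatically: it is a complete, algebraically closed field of characteristic 0 with a
  multiplicative ultrametric absolute value such that \<open>\<bar>p\<bar> = 1/p\<close>, in which the algebraic
  closure of \<open>\<rat>\<^sub>p\<close> is dense. These properties determine \<open>\<complex>\<^sub>p\<close> up to isometric isomorphism.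
\<close>

class nonarch_closed_field = alg_closed_field + field_char_0 + complete_space +
  fixes absv :: "'a \<Rightarrow> real"
  assumes dist_absv: "dist x y = absv (x - y)"
    and absv_mult: "absv (x * y) = absv x * absv y"
    and absv_add_le_max: "absv (x + y) \<le> max (absv x) (absv y)"

definition is_subfield :: "'a::field set \<Rightarrow> bool" where
  "is_subfield S \<longleftrightarrow> 1 \<in> S \<and> (\<forall>x\<in>S. \<forall>y\<in>S. x - y \<in> S \<and> x * y \<in> S) \<and> (\<forall>x\<in>S. inverse x \<in> S)"

definition algebraic_over :: "'a::field set \<Rightarrow> 'a \<Rightarrow> bool" where
  "algebraic_over S x \<longleftrightarrow> (\<exists>P. P \<noteq> 0 \<and> (\<forall>i. coeff P i \<in> S) \<and> poly P x = 0)"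

definition Qp :: "'k::nonarch_closed_field set" where
  "Qp = closure \<rat>"

definition is_Cp :: "nat \<Rightarrow> 'k::nonarch_closed_field itself \<Rightarrow> bool" where
  "is_Cp p _ \<longleftrightarrow> absv (of_nat p :: 'k) = 1 / real p \<and>
     closure {x :: 'k. algebraic_over Qp x} = UNIV"

definition is_Fp_bar :: "nat \<Rightarrow> 'r::alg_closed_field itself \<Rightarrow> bool" where
  "is_Fp_bar p _ \<longleftrightarrow> CHAR('r) = p \<and> (\<forall>x::'r. algebraic_over (range of_nat) x)"

text \<open>
  The reduction \<open>\<O> \<rightarrow> \<O>/\<mm>\<close>, with the residue field identified with \<open>'r\<close>. Values outside the unit
  ball are irrelevant.
\<close>

definition is_residue_map :: "('k::nonarch_closed_field \<Rightarrow> 'r::field) \<Rightarrow> bool" where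
  "is_residue_map red \<longleftrightarrow>
     red ` {x. absv x \<le> 1} = UNIV \<and> red 1 = 1 \<and>
     (\<forall>x y. absv x \<le> 1 \<longrightarrow> absv y \<le> 1 \<longrightarrow>
        red (x + y) = red x + red y \<and> red (x * y) = red x * red y) \<and>
     (\<forall>x. absv x \<le> 1 \<longrightarrow> (red x = 0 \<longleftrightarrow> absv x < 1))"

definition ordp :: "nat \<Rightarrow> 'k::nonarch_closed_field \<Rightarrow> real" where
  "ordp p x = - log (real p) (absv x)"

definition teich :: "nat \<Rightarrow> ('k::nonarch_closed_field \<Rightarrow> 'r::field) \<Rightarrow> 'r \<Rightarrow> 'k" where
  "teich p red x = (THE z. absv z \<le> 1 \<and> red z = x \<and> (\<exists>m>0. z ^ (p ^ m) = z))"

text \<open>\<open>\<rat>\<^sub>q\<close>, the unramified extension of \<open>\<rat>\<^sub>p\<close> of degree \<open>a\<close> (\<open>q = p\<^sup>a\<close>), is \<open>\<rat>\<^sub>p(\<mu>\<^bsub>q-1\<^esub>)\<close>.\<close>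

definition Qq :: "nat \<Rightarrow> 'k::nonarch_closed_field set" where
  "Qq q = is_subfield hull (Qp \<union> {z. z ^ (q - 1) = 1})"

text \<open>
  \<open>\<tau>\<close> is a function on the whole of \<open>\<complex>\<^sub>p\<close>, but only its values on \<open>\<rat>\<^sub>q\<close> (which are uniquely
  determined) matter.
\<close>

definition is_frobenius :: "nat \<Rightarrow> nat \<Rightarrow> ('k::nonarch_closed_field \<Rightarrow> 'k) \<Rightarrow> bool" where
  "is_frobenius p q \<tau> \<longleftrightarrow>
     bij_betw \<tau> (Qq q) (Qq q) \<and>
     (\<forall>x\<in>Qq q. \<forall>y\<in>Qq q. \<tau> (x + y) = \<tau> x + \<tau> y \<and> \<tau> (x * y) = \<tau> x * \<tau> y) \<and>
     (\<forall>x\<in>Qp. \<tau> x = x) \<and>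
     (\<forall>x\<in>Qq q. absv x \<le> 1 \<longrightarrow> absv (\<tau> x - x ^ p) < 1)"

definition is_dwork_root :: "nat \<Rightarrow> 'k::nonarch_closed_field \<Rightarrow> bool" where
  "is_dwork_root p \<gamma> \<longleftrightarrow>
     (\<lambda>i. \<gamma> ^ (p ^ i) / of_nat (p ^ i)) sums 0 \<and> ordp p \<gamma> = 1 / (real p - 1)"

definition artin_hasse :: "nat \<Rightarrow> 'k::field_char_0 fps" where
  "artin_hasse p = fps_exp 1 oo Abs_fps (\<lambda>n. if \<exists>i. n = p ^ i then 1 / of_nat n else 0)"

definition theta :: "nat \<Rightarrow> 'k::nonarch_closed_field \<Rightarrow> 'k \<Rightarrow> 'k" where
  "theta p \<gamma> t = suminf (\<lambda>n. fps_nth (artin_hasse p) n * (\<gamma> * t) ^ n)"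

text \<open>Finite fields are taken inside the fixed algebraic closure \<open>'r\<close> of \<open>\<bbbF>\<^sub>p\<close>.\<close>

definition GF :: "nat \<Rightarrow> 'r::field set" where
  "GF Q = {x. x ^ Q = x}"

text \<open>The trace from the field with \<open>Q\<^sup>m\<close> elements to the field with \<open>Q\<close> elements, as the
  sum of the conjugates.\<close>

definition ff_trace :: "nat \<Rightarrow> nat \<Rightarrow> 'r::field \<Rightarrow> 'r" where
  "ff_trace Q m x = (\<Sum>j<m. x ^ (Q ^ j))"

definition Theta :: "nat \<Rightarrow> ('k::nonarch_closed_field \<Rightarrow> 'r::field) \<Rightarrow> 'k \<Rightarrow> 'r \<Rightarrow> 'k" where
  "Theta p red \<gamma> z = theta p \<gamma> (teich p red z)"

definition psi :: "nat \<Rightarrow> nat \<Rightarrow> ('k::nonarch_closed_field \<Rightarrow> 'r::field) \<Rightarrow> 'k \<Rightarrow> 'r \<Rightarrow> 'k" where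
  "psi p a red \<gamma> z = Theta p red \<gamma> (ff_trace p a z)"

text \<open>
  A Laurent polynomial in the variables \<open>x\<^sub>i\<close>, \<open>i :: 'n\<close>, is a finitely supported function from
  exponent vectors to coefficients.
\<close>

type_synonym ('n, 'r) laurent = "('n \<Rightarrow> int) \<Rightarrow>\<^sub>0 'r"

definition laurent_eval :: "('n::finite, 'r::field) laurent \<Rightarrow> ('n \<Rightarrow> 'r) \<Rightarrow> 'r" where
  "laurent_eval f x = (\<Sum>u\<in>Poly_Mapping.keys f. Poly_Mapping.lookup f u * (\<Prod>i\<in>UNIV. x i powi u i))"

definition exp_sum ::
  "nat \<Rightarrow> nat \<Rightarrow> ('k::nonarch_closed_field \<Rightarrow> 'r::field) \<Rightarrow> 'k \<Rightarrow>
   ('n::finite, 'r) laurent \<Rightarrow> ('n \<Rightarrow> nat) \<Rightarrow> nat \<Rightarrow> 'k" where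
  "exp_sum p a red \<gamma> f d k =
     (\<Sum>x | \<forall>i. x i \<in> GF ((p ^ a) ^ (k * d i)) - {0}.
        psi p a red \<gamma> (ff_trace (p ^ a) (k * Lcm (range d)) (laurent_eval f x)))"

text \<open>
  The variables \<open>y\<^sub>i\<^sub>,\<^sub>j\<close> with \<open>j \<in> \<int>/d\<^sub>i\<int>\<close> are indexed by pairs \<open>(i, j)\<close> with \<open>j < d i\<close>.
\<close>

definition W_set :: "nat \<Rightarrow> ('n \<Rightarrow> nat) \<Rightarrow> nat \<Rightarrow> int \<Rightarrow> ('n::finite \<times> nat \<Rightarrow> 'r::field) set" where
  "W_set q d k b =
     {y \<in> (SIGMA i:UNIV. {..<d i}) \<rightarrow>\<^sub>E (UNIV - {0}).
        \<forall>i. \<forall>j<d i. y (i, j) ^ (q ^ k) = y (i, nat ((int j + b) mod int (d i)))}"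

text \<open>
  \<open>F\<close> depends on the coefficients \<open>c\<^sub>u\<close>, and \<open>F\<^sup>\<tau>\<close> is the same series with \<open>\<tau>(c\<^sub>u)\<close> in place of \<open>c\<^sub>u\<close>
  (\<open>\<tau>\<close> fixes \<open>\<gamma>\<close> and the rational coefficients of the Artin--Hasse series).
\<close>

definition dwork_F ::
  "nat \<Rightarrow> 'k::nonarch_closed_field \<Rightarrow> ('n::finite \<Rightarrow> int) set \<Rightarrow> (('n \<Rightarrow> int) \<Rightarrow> 'k) \<Rightarrow>
   ('n \<Rightarrow> nat) \<Rightarrow> ('n \<times> nat \<Rightarrow> 'k) \<Rightarrow> 'k" where
  "dwork_F p \<gamma> U c d y =
     (\<Prod>l<Lcm (range d). \<Prod>u\<in>U. theta p \<gamma> (c u * (\<Prod>i\<in>UNIV. y (i, l mod d i) powi u i)))"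

definition dwork_Fa ::
  "nat \<Rightarrow> nat \<Rightarrow> ('k::nonarch_closed_field \<Rightarrow> 'r::field) \<Rightarrow> 'k \<Rightarrow> ('k \<Rightarrow> 'k) \<Rightarrow>
   ('n::finite, 'r) laurent \<Rightarrow> ('n \<Rightarrow> nat) \<Rightarrow> ('n \<times> nat \<Rightarrow> 'k) \<Rightarrow> 'k" where
  "dwork_Fa p a red \<gamma> \<tau> f d y =
     (\<Prod>m<a. dwork_F p \<gamma> (Poly_Mapping.keys f)
                (\<lambda>u. (\<tau> ^^ m) (teich p red (Poly_Mapping.lookup f u))) d
                (\<lambda>ij. y ij ^ (p ^ m)))"

end

theory Submission
  imports Defs
begin

text \<open>
  Formally \<open>\<theta>(t) = exp (\<Sum>\<^sub>i (\<gamma>t)\<^bsup>p\<^sup>i\<^esup>/p\<^sup>i)\<close>. If elements \<open>t\<^sub>j\<close> of the unit ball and a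
  Teichmueller representative \<open>s\<close> of an element of \<open>\<bbbF>\<^sub>p\<close> satisfy
  \<open>\<Sum>\<^sub>j t\<^sub>j\<^bsup>p\<^sup>i\<^esup> - s = D\<close> for all \<open>i\<close> with \<open>D\<close> divisible by \<open>p\<close>, then
  \<open>\<Prod>\<^sub>j \<theta>(t\<^sub>j) / \<theta>(s) = exp (D \<Sum>\<^sub>i \<gamma>\<^bsup>p\<^sup>i\<^esup>/p\<^sup>i) = 1\<close>. Taking for \<open>t\<^sub>j\<close> all the Frobenius conjugates of
  the lifted monomials of \<open>f\<close> gives Dwork's splitting of the additive character of a trace, with
  the multiplicativity of \<open>\<Theta>\<close> on \<open>\<bbbF>\<^sub>p\<close> as a special case.

  On the torus side, a point \<open>y\<close> of \<open>W\<close> is determined by \<open>x\<^sub>i = y\<^sub>i\<^sub>,\<^sub>0\<close>, since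
  \<open>y\<^sub>i\<^sub>,\<^sub>r\<^sub>b = x\<^sub>i\<close> raised to \<open>q\<^bsup>kr\<^esup>\<close> and \<open>b\<close> is invertible modulo each \<open>d\<^sub>i\<close>. Substituting \<open>l = rb\<close>
  in the product over \<open>l\<close> modulo \<open>d\<close> turns the factors of \<open>F\<^sub>a\<close> into the conjugates in the trace.
\<close>

section \<open>Ultrametric analysis\<close>

lemma absv_eq_dist: "absv (x :: 'k::nonarch_closed_field) = dist x 0"
  by (simp add: dist_absv)

lemma absv_nonneg [simp]: "absv (x :: 'k::nonarch_closed_field) \<ge> 0"
  by (simp add: absv_eq_dist)

lemma absv_0 [simp]: "absv (0 :: 'k::nonarch_closed_field) = 0"
  by (simp add: absv_eq_dist)

lemma absv_eq_0_iff [simp]: "absv (x :: 'k::nonarch_closed_field) = 0 \<longleftrightarrow> x = 0"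
  by (simp add: absv_eq_dist)

lemma absv_pos_iff [simp]: "absv (x :: 'k::nonarch_closed_field) > 0 \<longleftrightarrow> x \<noteq> 0"
  by (simp add: absv_eq_dist)

lemma absv_1 [simp]: "absv (1 :: 'k::nonarch_closed_field) = 1"
proof -
  have "absv (1::'k) * absv (1::'k) = absv (1::'k) * 1"
    by (simp flip: absv_mult)
  thus ?thesis
    using mult_left_cancel[of "absv (1::'k)"] by fastforce
qed

lemma absv_minus_commute: "absv (x - y :: 'k::nonarch_closed_field) = absv (y - x)"
  by (simp flip: dist_absv add: dist_commute)

lemma absv_minus [simp]: "absv (- x :: 'k::nonarch_closed_field) = absv x"
  using absv_minus_commute[of 0 x] by simp

lemma absv_power: "absv (x ^ n :: 'k::nonarch_closed_field) = absv x ^ n"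
  by (induction n) (auto simp: absv_mult)

lemma absv_inverse: "absv (inverse x :: 'k::nonarch_closed_field) = inverse (absv x)"
proof (cases "x = 0")
  case False
  hence "absv x * absv (inverse x) = 1"
    by (simp flip: absv_mult)
  thus ?thesis
    using inverse_unique by metis
qed auto

lemma absv_divide: "absv (x / y :: 'k::nonarch_closed_field) = absv x / absv y"
  by (simp add: divide_inverse absv_mult absv_inverse)

lemma absv_add_le:
  "absv (x :: 'k::nonarch_closed_field) \<le> B \<Longrightarrow> absv y \<le> B \<Longrightarrow> absv (x + y) \<le> B"
  using absv_add_le_max[of x y] by linarith

lemma absv_diff_le:
  "absv (x :: 'k::nonarch_closed_field) \<le> B \<Longrightarrow> absv y \<le> B \<Longrightarrow> absv (x - y) \<le> B"
  using absv_add_le[of x B "-y"] by simp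

lemma absv_add_less:
  "absv (x :: 'k::nonarch_closed_field) < B \<Longrightarrow> absv y < B \<Longrightarrow> absv (x + y) < B"
  using absv_add_le_max[of x y] by linarith

lemma absv_sum_le:
  assumes "B \<ge> 0" "\<And>i. i \<in> A \<Longrightarrow> absv (f i :: 'k::nonarch_closed_field) \<le> B"
  shows "absv (sum f A) \<le> B"
  using assms by (induction A rule: infinite_finite_induct) (auto intro: absv_add_le)

lemma absv_of_nat_le_1: "absv (of_nat n :: 'k::nonarch_closed_field) \<le> 1"
  by (induction n) (auto intro: absv_add_le)

lemma absv_of_int_le_1: "absv (of_int n :: 'k::nonarch_closed_field) \<le> 1"
  using absv_of_nat_le_1[of "nat \<bar>n\<bar>", where 'k = 'k]
  by (cases "n \<ge> 0") auto

lemma absv_add_eq: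
  assumes "absv (x :: 'k::nonarch_closed_field) < absv y"
  shows "absv (x + y) = absv y"
proof (rule antisym)
  show "absv (x + y) \<le> absv y"
    using assms by (intro absv_add_le) auto
  show "absv y \<le> absv (x + y)"
    using absv_add_le_max[of "x + y" "-x"] assms by auto
qed

section \<open>Limits and convergence of series in the ultrametric topology\<close>

lemma tendsto_iff_absv:
  "(f \<longlongrightarrow> (a :: 'k::nonarch_closed_field)) F \<longleftrightarrow> ((\<lambda>x. absv (f x - a)) \<longlongrightarrow> 0) F"
  by (subst tendsto_dist_iff) (simp add: dist_absv)

lemma tendsto_0_absv_le:
  assumes "(g \<longlongrightarrow> 0) F" "\<And>x. absv (f x :: 'k::nonarch_closed_field) \<le> g x"
  shows "(f \<longlongrightarrow> 0) F"
  unfolding tendsto_iff_absv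
  by (rule tendsto_sandwich[OF _ _ tendsto_const assms(1)]) (use assms(2) in auto)

text \<open>The class only ties the metric to \<open>absv\<close>. Continuity of addition, and of
  multiplication below, gives access to the general theory of limits and infinite sums.\<close>

instance nonarch_closed_field \<subseteq> topological_ab_group_add
proof
  fix a b :: 'a
  have fst: "(fst \<longlongrightarrow> a) (nhds a \<times>\<^sub>F nhds b)" and snd: "(snd \<longlongrightarrow> b) (nhds a \<times>\<^sub>F nhds b)"
    by (rule filterlim_fst filterlim_snd)+
  show "((\<lambda>x. fst x + snd x) \<longlongrightarrow> a + b) (nhds a \<times>\<^sub>F nhds b)"
    unfolding tendsto_iff_absv
  proof (rule tendsto_sandwich[OF _ _ tendsto_const])
    show "((\<lambda>x. max (absv (fst x - a)) (absv (snd x - b))) \<longlongrightarrow> 0) (nhds a \<times>\<^sub>F nhds b)"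
      using tendsto_max[OF fst[unfolded tendsto_iff_absv] snd[unfolded tendsto_iff_absv]] by simp
    have "absv (fst x + snd x - (a + b)) \<le> max (absv (fst x - a)) (absv (snd x - b))" for x
      using absv_add_le_max[of "fst x - a" "snd x - b"] by (simp add: algebra_simps)
    thus "\<forall>\<^sub>F x in nhds a \<times>\<^sub>F nhds b.
            absv (fst x + snd x - (a + b)) \<le> max (absv (fst x - a)) (absv (snd x - b))"
      by simp
  qed auto
  show "(uminus \<longlongrightarrow> - a) (nhds a)"
    unfolding tendsto_iff_absv
    using filterlim_ident[of "nhds a", unfolded tendsto_iff_absv]
    by (simp add: absv_minus_commute)
qed

instance nonarch_closed_field \<subseteq> topological_semigroup_mult
proof
  fix a b :: 'a
  let ?F = "nhds a \<times>\<^sub>F nhds b"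
  have fst: "((\<lambda>x. absv (fst x - a)) \<longlongrightarrow> 0) ?F" and snd: "((\<lambda>x. absv (snd x - b)) \<longlongrightarrow> 0) ?F"
    by (simp_all only: tendsto_iff_absv[symmetric] filterlim_fst filterlim_snd)
  show "((\<lambda>x. fst x * snd x) \<longlongrightarrow> a * b) ?F"
    unfolding tendsto_iff_absv
  proof (rule tendsto_sandwich[OF _ _ tendsto_const])
    let ?g = "\<lambda>x. absv (fst x - a) * absv (snd x - b) + absv a * absv (snd x - b)
                    + absv (fst x - a) * absv b"
    show "(?g \<longlongrightarrow> 0) ?F"
      by (rule tendsto_eq_intros fst snd refl)+ simp
    have "absv (fst x * snd x - a * b) \<le> ?g x" for x
    proof -
      have *: "fst x * snd x - a * b =
               (fst x - a) * (snd x - b) + a * (snd x - b) + (fst x - a) * b"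
        by (simp add: algebra_simps)
      show ?thesis
        unfolding *
        by (intro absv_add_le) (auto simp: absv_mult)
    qed
    thus "\<forall>\<^sub>F x in ?F. absv (fst x * snd x - a * b) \<le> ?g x"
      by simp
  qed auto
qed

lemma tendsto_absv_le:
  assumes "f \<longlonglongrightarrow> (a :: 'k::nonarch_closed_field)" "\<And>n. absv (f n) \<le> B"
  shows "absv a \<le> B"
proof -
  have "(\<lambda>n. dist (f n) 0) \<longlonglongrightarrow> dist a 0"
    by (intro tendsto_intros assms(1))
  thus ?thesis
    using assms(2) by (intro LIMSEQ_le_const2[of "\<lambda>n. absv (f n)"]) (auto simp: absv_eq_dist)
qed

text \<open>A block of consecutive terms is at most as large as its largest term, so terms tending
  to 0 already make the partial sums Cauchy; completeness does the rest.\<close>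

lemma summable_nonarch:
  assumes "f \<longlonglongrightarrow> (0 :: 'k::nonarch_closed_field)"
  shows "summable f"
proof -
  have "Cauchy (\<lambda>n. sum f {..<n})"
  proof (rule metric_CauchyI)
    fix e :: real assume e: "e > 0"
    with assms obtain N where N: "\<And>n. n \<ge> N \<Longrightarrow> absv (f n) < e"
      by (auto simp: lim_sequentially absv_eq_dist)
    have *: "absv (sum f {..<n} - sum f {..<m}) \<le> Max (insert 0 (absv ` f ` {m..<n})) \<and>
             Max (insert 0 (absv ` f ` {m..<n})) < e" if "m \<ge> N" "m \<le> n" for m n
    proof (intro conjI)
      have "sum f {..<n} - sum f {..<m} = sum f {m..<n}"
        using that sum_diff_nat_ivl[of 0 m n f] by (simp add: atLeast0LessThan)
      also have "absv \<dots> \<le> Max (insert 0 (absv ` f ` {m..<n}))"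
        by (intro absv_sum_le Max_ge) auto
      finally show "absv (sum f {..<n} - sum f {..<m}) \<le> Max (insert 0 (absv ` f ` {m..<n}))" .
    qed (use N that e in auto)
    have "dist (sum f {..<m}) (sum f {..<n}) < e" if "m \<ge> N" "n \<ge> N" for m n
      using *[of m n] *[of n m] that absv_minus_commute[of "sum f {..<n}" "sum f {..<m}"]
      unfolding dist_absv by (cases "m \<le> n") linarith+
    thus "\<exists>M. \<forall>m\<ge>M. \<forall>n\<ge>M. dist (sum f {..<m}) (sum f {..<n}) < e"
      by blast
  qed
  thus ?thesis
    by (simp add: summable_iff_convergent Cauchy_convergent_iff)
qed

section \<open>Evaluation of power series at 1\<close>

text \<open>These are the series converging on the closed unit disc. Evaluation at 1 is enough for
  them because an argument \<open>t\<close> is put into the coefficients by substituting a multiple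
  of \<open>X\<close>.\<close>

definition fps_null :: "'k::nonarch_closed_field fps \<Rightarrow> bool" where
  "fps_null F \<longleftrightarrow> fps_nth F \<longlonglongrightarrow> 0"

definition fps_ev1 :: "'k::nonarch_closed_field fps \<Rightarrow> 'k" where
  "fps_ev1 F = suminf (fps_nth F)"

text \<open>\<open>B\<close> bounds the Gauss norm, the supremum of the absolute values of the
  coefficients. Being uniform in the index, the bound survives evaluation at 1.\<close>

definition fps_le :: "real \<Rightarrow> 'k::nonarch_closed_field fps \<Rightarrow> bool" where
  "fps_le B F \<longleftrightarrow> (\<forall>n. absv (fps_nth F n) \<le> B)"

lemma fps_le_add: "fps_le B F \<Longrightarrow> fps_le B G \<Longrightarrow> fps_le B (F + G)"
  by (auto simp: fps_le_def intro: absv_add_le)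

lemma fps_le_sum:
  "B \<ge> 0 \<Longrightarrow> (\<And>i. i \<in> A \<Longrightarrow> fps_le B (F i)) \<Longrightarrow> fps_le B (sum F A)"
  by (auto simp: fps_le_def fps_sum_nth intro: absv_sum_le)

lemma fps_le_nonneg: "fps_le B F \<Longrightarrow> B \<ge> 0"
  unfolding fps_le_def using absv_nonneg order_trans by blast

lemma fps_le_mult:
  assumes "fps_le B F" "fps_le C G"
  shows "fps_le (B * C) (F * G)"
  using assms fps_le_nonneg[OF assms(1)] fps_le_nonneg[OF assms(2)]
  unfolding fps_le_def fps_mult_nth
  by (intro allI absv_sum_le) (auto simp: absv_mult intro: mult_mono)

lemma fps_le_1: "fps_le 1 1"
  by (simp add: fps_le_def fps_one_nth)

lemma fps_le_power: "fps_le B F \<Longrightarrow> fps_le (B ^ n) (F ^ n)"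
  by (induction n) (auto simp: fps_le_1 intro: fps_le_mult)

lemma fps_le_const: "absv c \<le> B \<Longrightarrow> fps_le B (fps_const c)"
  using order_trans[OF absv_nonneg[of c]] by (auto simp: fps_le_def)

lemma fps_null_bound:
  assumes "fps_null F"
  obtains B where "B > 0" "fps_le B F"
proof -
  have "bounded (range (fps_nth F))"
    using assms by (auto simp: fps_null_def intro: convergent_imp_bounded)
  then obtain B where "\<And>n. dist 0 (fps_nth F n) \<le> B"
    by (auto simp: bounded_any_center[of _ 0])
  hence "fps_le (max B 1) F"
    by (auto simp: fps_le_def absv_eq_dist dist_commute intro: max.coboundedI1)
  thus ?thesis
    using that[of "max B 1"] by simp
qed

lemma fps_nth_add_eq: "fps_nth (F + G) = (\<lambda>n. fps_nth F n + fps_nth G n)"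
  and fps_nth_diff_eq: "fps_nth (F' - G') = (\<lambda>n. fps_nth F' n - fps_nth G' n)"
  and fps_nth_const_eq: "fps_nth (fps_const c) = (\<lambda>n. if n = 0 then c else 0)"
  by (auto simp: fun_eq_iff)

lemma fps_null_add: "fps_null F \<Longrightarrow> fps_null G \<Longrightarrow> fps_null (F + G)"
  unfolding fps_null_def fps_nth_add_eq
  using tendsto_add[of "fps_nth F" 0 sequentially "fps_nth G" 0] by simp

lemma fps_null_diff: "fps_null F \<Longrightarrow> fps_null G \<Longrightarrow> fps_null (F - G)"
  unfolding fps_null_def fps_nth_diff_eq
  using tendsto_diff[of "fps_nth F" 0 sequentially "fps_nth G" 0] by simp

lemma fps_null_const [simp]: "fps_null (fps_const c)"
  unfolding fps_null_def fps_nth_const_eq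
  by (rule tendsto_eventually) (use eventually_gt_at_top[of 0] in eventually_elim, auto)

lemma fps_null_sums: "fps_null F \<Longrightarrow> fps_nth F sums fps_ev1 F"
  unfolding fps_null_def fps_ev1_def by (intro summable_sums summable_nonarch)

lemma fps_ev1_eqI: "fps_nth F sums x \<Longrightarrow> fps_ev1 F = x"
  unfolding fps_ev1_def by (rule sums_unique[symmetric])

lemma fps_ev1_add: "fps_null F \<Longrightarrow> fps_null G \<Longrightarrow> fps_ev1 (F + G) = fps_ev1 F + fps_ev1 G"
  using sums_add[OF fps_null_sums fps_null_sums, of F G]
  by (intro fps_ev1_eqI) (simp add: fps_nth_add_eq)

lemma fps_ev1_diff: "fps_null F \<Longrightarrow> fps_null G \<Longrightarrow> fps_ev1 (F - G) = fps_ev1 F - fps_ev1 G"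
  using fps_ev1_add[of "F - G" G] fps_null_diff[of F G] by (simp add: algebra_simps)

lemma fps_ev1_const [simp]: "fps_ev1 (fps_const c) = c"
  by (rule fps_ev1_eqI) (use sums_single[of 0 "\<lambda>_. c"] in \<open>simp add: fps_nth_const_eq\<close>)

lemma absv_fps_ev1_le:
  assumes "fps_null F" "fps_le B F"
  shows "absv (fps_ev1 F) \<le> B"
  using fps_null_sums[OF assms(1)] assms(2) fps_le_nonneg[OF assms(2)] unfolding sums_def
  by (elim tendsto_absv_le) (auto simp: fps_le_def intro: absv_sum_le)

text \<open>This sum is what the product of two partial sums has beyond the partial sum of the
  Cauchy product. For \<open>n \<ge> M + N\<close> each pair has \<open>i \<ge> M\<close> or
  \<open>j \<ge> N\<close>, so one factor is small and the other bounded.\<close>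

lemma fps_cauchy_product_tail:
  assumes F: "fps_null F" and G: "fps_null G"
  shows "(\<lambda>n. (\<Sum>(i,j)\<in>{(i,j). i < n \<and> j < n \<and> i + j \<ge> n}. fps_nth F i * fps_nth G j)) \<longlonglongrightarrow> 0"
proof -
  obtain A B where A: "A > 0" "fps_le A F" and B: "B > 0" "fps_le B G"
    using fps_null_bound[OF F] fps_null_bound[OF G] by metis
  have "eventually (\<lambda>n. absv (\<Sum>(i,j)\<in>{(i,j). i < n \<and> j < n \<and> i + j \<ge> n}.
          fps_nth F i * fps_nth G j) < e) sequentially" if e: "e > 0" for e
  proof -
    obtain M where M: "\<And>i. i \<ge> M \<Longrightarrow> absv (fps_nth F i) < e / 2 / B"
      using F[unfolded fps_null_def lim_sequentially, rule_format, of "e / 2 / B"] B e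
      by (auto simp: absv_eq_dist)
    obtain N where N: "\<And>i. i \<ge> N \<Longrightarrow> absv (fps_nth G i) < e / 2 / A"
      using G[unfolded fps_null_def lim_sequentially, rule_format, of "e / 2 / A"] A e
      by (auto simp: absv_eq_dist)
    have "absv (\<Sum>(i,j)\<in>{(i,j). i < n \<and> j < n \<and> i + j \<ge> n}. fps_nth F i * fps_nth G j) \<le> e / 2"
      if n: "n \<ge> M + N" for n
    proof (rule absv_sum_le)
      fix x assume "x \<in> {(i,j). i < n \<and> j < n \<and> i + j \<ge> n}"
      then obtain i j where x: "x = (i, j)" and ij: "i < n" "j < n" "i + j \<ge> n"
        by auto
      show "absv (case x of (i, j) \<Rightarrow> fps_nth F i * fps_nth G j) \<le> e / 2"
      proof (cases "i \<ge> M")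
        case True
        have "absv (fps_nth F i) * absv (fps_nth G j) \<le> e / 2 / B * B"
          using M[OF True] B e by (intro mult_mono) (auto simp: fps_le_def)
        thus ?thesis using B by (simp add: x absv_mult)
      next
        case False
        with ij n have "j \<ge> N" by simp
        hence "absv (fps_nth F i) * absv (fps_nth G j) \<le> A * (e / 2 / A)"
          using N[of j] A e by (intro mult_mono) (auto simp: fps_le_def)
        thus ?thesis using A by (simp add: x absv_mult)
      qed
    qed (use e in auto)
    thus ?thesis
      using e by (intro eventually_mono[OF eventually_ge_at_top[of "M + N"]]) force
  qed
  thus ?thesis
    by (auto simp: tendsto_iff absv_eq_dist)
qed

lemma fps_mult_null_sums:
  assumes F: "fps_null F" and G: "fps_null G"
  shows "fps_nth (F * G) sums (fps_ev1 F * fps_ev1 G)"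
proof -
  let ?T = "\<lambda>n. {(i,j). i < n \<and> j < n \<and> i + j \<ge> n} :: (nat \<times> nat) set"
  let ?h = "\<lambda>(i,j). fps_nth F i * fps_nth G j"
  have *: "sum (fps_nth (F * G)) {..<n} =
          sum (fps_nth F) {..<n} * sum (fps_nth G) {..<n} - sum ?h (?T n)" for n
  proof -
    have fin: "finite (?T n)"
      by (rule finite_subset[of _ "{..<n} \<times> {..<n}"]) auto
    have fin': "finite {(i,j). i + j < n}"
      by (rule finite_subset[of _ "{..<n} \<times> {..<n}"]) auto
    have "sum (fps_nth (F * G)) {..<n} = (\<Sum>k<n. \<Sum>i\<le>k. fps_nth F i * fps_nth G (k - i))"
      by (simp add: fps_mult_nth atLeast0AtMost)
    also have "\<dots> = sum ?h {(i,j). i + j < n}"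
      using sum.triangle_reindex[of "\<lambda>i j. fps_nth F i * fps_nth G j" n] by simp
    finally have 1: "sum (fps_nth (F * G)) {..<n} = sum ?h {(i,j). i + j < n}" .
    have "sum (fps_nth F) {..<n} * sum (fps_nth G) {..<n} = sum ?h ({..<n} \<times> {..<n})"
      by (simp add: sum_product sum.cartesian_product)
    also have "{..<n} \<times> {..<n} = {(i,j). i + j < n} \<union> ?T n"
      by auto
    also have "sum ?h \<dots> = sum ?h {(i,j). i + j < n} + sum ?h (?T n)"
      using fin fin' by (intro sum.union_disjoint) auto
    finally show ?thesis
      using 1 by simp
  qed
  have "(\<lambda>n. sum (fps_nth F) {..<n} * sum (fps_nth G) {..<n} - sum ?h (?T n))
           \<longlonglongrightarrow> fps_ev1 F * fps_ev1 G - 0"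
    using fps_null_sums[OF F] fps_null_sums[OF G] fps_cauchy_product_tail[OF F G]
    unfolding sums_def by (intro tendsto_diff tendsto_mult)
  thus ?thesis
    unfolding sums_def * by simp
qed

text \<open>The coefficients of the product are differences of consecutive partial sums of a
  convergent series.\<close>

lemma fps_null_mult:
  assumes "fps_null F" "fps_null G"
  shows "fps_null (F * G)"
proof -
  let ?S = "\<lambda>n. sum (fps_nth (F * G)) {..<n}"
  have lim: "?S \<longlonglongrightarrow> fps_ev1 F * fps_ev1 G"
    using fps_mult_null_sums[OF assms] by (simp add: sums_def)
  have "(\<lambda>n. ?S (Suc n) - ?S n) \<longlonglongrightarrow> fps_ev1 F * fps_ev1 G - fps_ev1 F * fps_ev1 G"
    by (intro tendsto_diff lim LIMSEQ_Suc)
  thus ?thesis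
    by (simp add: fps_null_def)
qed

lemma fps_ev1_mult:
  "fps_null F \<Longrightarrow> fps_null G \<Longrightarrow> fps_ev1 (F * G) = fps_ev1 F * fps_ev1 G"
  by (intro fps_ev1_eqI fps_mult_null_sums)

lemma fps_null_1: "fps_null 1" and fps_ev1_1: "fps_ev1 1 = 1"
  using fps_null_const[of 1] fps_ev1_const[of 1] by simp_all

lemma fps_null_power: "fps_null F \<Longrightarrow> fps_null (F ^ n)"
  by (induction n) (auto simp: fps_null_1 fps_null_mult)

lemma fps_ev1_power: "fps_null F \<Longrightarrow> fps_ev1 (F ^ n) = fps_ev1 F ^ n"
  by (induction n) (auto simp: fps_ev1_1 fps_ev1_mult fps_null_power)

lemma fps_null_ev1_prod:
  assumes "\<And>i. i \<in> A \<Longrightarrow> fps_null (F i)"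
  shows "fps_null (prod F A) \<and> fps_ev1 (prod F A) = (\<Prod>i\<in>A. fps_ev1 (F i))"
  using assms
  by (induction A rule: infinite_finite_induct)
     (auto simp: fps_null_1 fps_ev1_1 fps_null_mult fps_ev1_mult)

lemma fps_null_ev1_sum:
  assumes "\<And>i. i \<in> A \<Longrightarrow> fps_null (F i)"
  shows "fps_null (sum F A) \<and> fps_ev1 (sum F A) = (\<Sum>i\<in>A. fps_ev1 (F i))"
  using assms fps_null_const[of 0] fps_ev1_const[of 0]
  by (induction A rule: infinite_finite_induct)
     (auto simp del: fps_null_const fps_ev1_const simp: fps_null_add fps_ev1_add)

section \<open>The \<open>p\<close>-adic absolute value\<close>

text \<open>The prime \<open>p\<close> divides every middle binomial coefficient. The factor
  \<open>p\<close> stays explicit over any commutative ring so that one identity serves integers,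
  field elements and power series.\<close>

lemma binomial_prime_power:
  fixes x y :: "'a::comm_ring_1"
  assumes "prime p"
  shows "(x + y) ^ p = x ^ p + y ^ p +
           of_nat p * (\<Sum>k=1..<p. of_nat ((p choose k) div p) * (x ^ k * y ^ (p - k)))"
proof -
  have p: "p > 1" using assms prime_gt_1_nat by auto
  have "(x + y) ^ p = (\<Sum>k\<le>p. of_nat (p choose k) * x ^ k * y ^ (p - k))"
    by (rule binomial_ring)
  also have "{..p} = insert 0 (insert p {1..<p})"
    using p by auto
  also have "(\<Sum>k\<in>\<dots>. of_nat (p choose k) * x ^ k * y ^ (p - k)) =
      x ^ p + y ^ p + (\<Sum>k=1..<p. of_nat (p choose k) * x ^ k * y ^ (p - k))"
    using p by (subst sum.insert; simp)
  also have "(\<Sum>k=1..<p. of_nat (p choose k) * x ^ k * y ^ (p - k)) =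
      of_nat p * (\<Sum>k=1..<p. of_nat ((p choose k) div p) * (x ^ k * y ^ (p - k)))"
    unfolding sum_distrib_left
  proof (intro sum.cong refl)
    fix k assume "k \<in> {1..<p}"
    hence "p dvd (p choose k)"
      using assms by (intro dvd_choose_prime) auto
    hence "of_nat (p choose k) = (of_nat p * of_nat ((p choose k) div p) :: 'a)"
      by (simp flip: of_nat_mult)
    thus "of_nat (p choose k) * x ^ k * y ^ (p - k) =
          of_nat p * (of_nat ((p choose k) div p) * (x ^ k * y ^ (p - k)))"
      by (simp add: mult_ac)
  qed
  finally show ?thesis .
qed

lemma int_fermat:
  assumes "prime (p::nat)"
  shows "int p dvd x ^ p - x"
proof -
  have step: "int p dvd (i + 1) ^ p - (i + 1) \<longleftrightarrow> int p dvd i ^ p - i" for i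
  proof -
    obtain C where "(i + 1) ^ p = i ^ p + 1 ^ p + int p * C"
      using binomial_prime_power[OF assms, of i 1] by blast
    hence "(i + 1) ^ p - (i + 1) = (i ^ p - i) + int p * C"
      by simp
    thus ?thesis
      by (metis dvd_add_left_iff dvd_triv_left)
  qed
  show ?thesis
  proof (induction x rule: int_induct[of _ 0])
    case base
    show ?case using assms by (simp add: prime_gt_0_nat power_0_left)
  next
    case (step1 i)
    thus ?case using step[of i] by simp
  next
    case (step2 i)
    thus ?case using step[of "i - 1"] by simp
  qed
qed

section \<open>Integers, rationals and p-th powers under the p-adic absolute value\<close>

locale Cp =
  fixes p :: nat and K :: "'k::nonarch_closed_field itself"
  assumes prime_p: "prime p"
  assumes absv_p: "absv (of_nat p :: 'k) = 1 / real p"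
begin

lemma p_gt_1: "p > 1" and p_pos: "p > 0" and p_ge_2: "p \<ge> 2"
  using prime_gt_1_nat[OF prime_p] by auto

lemma absv_of_int_dvd:
  assumes "int p dvd n"
  shows "absv (of_int n :: 'k) \<le> 1 / p"
proof -
  obtain m where "n = int p * m" using assms by blast
  thus ?thesis
    using mult_left_mono[OF absv_of_int_le_1[of m, where 'k = 'k], of "1 / real p"]
    by (simp add: absv_mult absv_p)
qed

text \<open>By Bezout some integer \<open>b\<close> satisfies \<open>b n = 1 - a p\<close>, which
  has absolute value 1 since \<open>a p\<close> is small. Neither factor exceeds 1, so both have
  absolute value 1.\<close>

lemma absv_of_int_unit:
  assumes "\<not> int p dvd n"
  shows "absv (of_int n :: 'k) = 1"
proof -
  have "coprime (int p) n"
    using assms prime_p by (simp add: prime_imp_coprime)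
  then obtain a b where ab: "a * int p + b * n = 1"
    by (metis bezout_int coprime_iff_gcd_eq_1)
  have "of_int (b * n) = (1 :: 'k) - of_int (a * int p)"
    using arg_cong[OF ab, of "of_int :: int \<Rightarrow> 'k"] by (simp add: algebra_simps)
  moreover have "absv (- of_int (a * int p) + 1 :: 'k) = absv (1 :: 'k)"
    using absv_of_int_dvd[of "a * int p"] p_gt_1
    by (intro absv_add_eq) (auto intro: le_less_trans)
  ultimately have "absv (of_int b * of_int n :: 'k) = 1"
    by simp
  thus ?thesis
    using absv_of_int_le_1[of b, where 'k = 'k] absv_of_int_le_1[of n, where 'k = 'k]
    by (metis absv_mult absv_nonneg antisym mult.commute mult.right_neutral mult_left_mono)
qed

lemma absv_of_nat_unit: "\<not> p dvd n \<Longrightarrow> absv (of_nat n :: 'k) = 1"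
  using absv_of_int_unit[of "int n"] by simp

text \<open>In lowest terms such a rational has a denominator prime to \<open>p\<close>, so the
  claim follows from Fermat's congruence for numerator and denominator.\<close>

lemma absv_fermat_rat:
  assumes "x \<in> \<rat>" "absv (x :: 'k) \<le> 1"
  shows "absv (x ^ p - x) \<le> 1 / p"
proof -
  obtain u v where uv: "v > 0" "coprime u v" and x: "x = of_int u / of_int v"
    using assms(1) by (rule Rats_cases')
  have "\<not> int p dvd v"
  proof
    assume v: "int p dvd v"
    hence "\<not> int p dvd u"
      using uv prime_p by (meson coprime_common_divisor not_prime_unit prime_nat_int_transfer)
    hence "absv (of_int u :: 'k) = 1"
      by (rule absv_of_int_unit)
    moreover have "absv (of_int u :: 'k) \<le> absv (of_int v :: 'k)"
      using assms(2) uv by (simp add: x absv_divide divide_le_eq)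
    ultimately show False
      using absv_of_int_dvd[OF v] p_gt_1 by (smt (verit) divide_less_eq_1_pos of_nat_1 of_nat_less_iff)
  qed
  hence v: "absv (of_int v :: 'k) = 1"
    by (rule absv_of_int_unit)
  have "x ^ p - x = of_int (u ^ p * v - u * v ^ p) / of_int (v ^ p * v)"
    using uv by (simp add: x field_simps)
  hence "absv (x ^ p - x) = absv (of_int (u ^ p * v - u * v ^ p) :: 'k)"
    by (simp add: absv_divide absv_mult absv_power v)
  also have "u ^ p * v - u * v ^ p = (u ^ p - u) * v - u * (v ^ p - v)"
    by (simp add: algebra_simps)
  also have "absv (of_int \<dots> :: 'k) \<le> 1 / p"
    by (intro absv_of_int_dvd dvd_diff dvd_mult dvd_mult2 int_fermat prime_p)
  finally show ?thesis .
qed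

lemma absv_of_nat_p_mult_le: "absv (x::'k) \<le> 1 \<Longrightarrow> absv (of_nat p * x) \<le> 1 / p"
  using mult_left_mono[of "absv x" 1 "1 / real p"] by (simp add: absv_mult absv_p)

lemma absv_freshman:
  assumes "absv (x::'k) \<le> 1" "absv y \<le> 1"
  shows "absv ((x + y) ^ p - (x ^ p + y ^ p)) \<le> 1 / p"
  unfolding binomial_prime_power[OF prime_p] add_diff_cancel_left'
  using assms
  by (intro absv_of_nat_p_mult_le absv_sum_le)
     (auto simp: absv_mult absv_power power_le_one mult_le_one absv_of_nat_le_1)

lemma absv_freshman_sum:
  assumes "finite A" "\<And>i. i \<in> A \<Longrightarrow> absv (f i :: 'k) \<le> 1"
  shows "absv ((\<Sum>i\<in>A. f i) ^ p - (\<Sum>i\<in>A. f i ^ p)) \<le> 1 / p"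
  using assms
proof (induction A rule: finite_induct)
  case (insert a A)
  have "absv (((f a + sum f A) ^ p - (f a ^ p + sum f A ^ p)) +
              (sum f A ^ p - (\<Sum>i\<in>A. f i ^ p))) \<le> 1 / p"
    using insert by (intro absv_add_le absv_freshman absv_sum_le) auto
  thus ?case using insert.hyps by (simp add: algebra_simps)
qed (use p_pos in \<open>auto simp: power_0_left\<close>)

text \<open>With \<open>D\<close> the difference of the sum and \<open>s\<close>, the binomial
  congruence and the two invariance hypotheses make \<open>D ^ p - D\<close> divisible by
  \<open>p\<close>. As \<open>absv D < 1\<close>, the term \<open>D ^ p\<close> is strictly smaller
  than a nonzero \<open>D\<close>, so \<open>D\<close> itself is divisible by \<open>p\<close>: a
  congruence modulo the maximal ideal improves to one modulo \<open>p\<close>.\<close>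

lemma absv_less_1_imp_le:
  assumes "finite A" "\<And>i. i \<in> A \<Longrightarrow> absv (t i :: 'k) \<le> 1"
  assumes "(\<Sum>i\<in>A. t i ^ p) = (\<Sum>i\<in>A. t i)"
  assumes "s ^ p = s" "absv s \<le> 1" "absv ((\<Sum>i\<in>A. t i) - s) < 1"
  shows "absv ((\<Sum>i\<in>A. t i) - s) \<le> 1 / p"
proof -
  define T D where "T = (\<Sum>i\<in>A. t i)" and "D = T - s"
  have 1: "absv (T ^ p - T) \<le> 1 / p"
    using absv_freshman_sum[of A t, OF assms(1,2)] assms(3) by (simp add: T_def)
  have 2: "absv ((s + D) ^ p - (s ^ p + D ^ p)) \<le> 1 / p"
    using assms(5,6) by (intro absv_freshman) (auto simp: D_def T_def)
  have "absv ((T ^ p - T) - ((s + D) ^ p - (s ^ p + D ^ p))) \<le> 1 / p"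
    by (rule absv_diff_le[OF 1 2])
  also have "(T ^ p - T) - ((s + D) ^ p - (s ^ p + D ^ p)) = D ^ p + - D"
    by (simp add: D_def assms(4))
  finally have 3: "absv (D ^ p + - D) \<le> 1 / p" .
  show ?thesis
  proof (cases "D = 0")
    case False
    have "absv D < 1" using assms(6) by (simp add: D_def T_def)
    hence "absv D ^ p < absv D ^ 1"
      using False p_gt_1 by (intro power_strict_decreasing) auto
    hence "absv (D ^ p + - D) = absv (- D)"
      by (intro absv_add_eq) (simp add: absv_power)
    thus ?thesis using 3 by (simp flip: D_def T_def)
  qed (use D_def T_def in auto)
qed

text \<open>Among the factors from \<open>p * k + 1\<close> to \<open>p * (k + 1)\<close> only the
  last is divisible by \<open>p\<close>; it contributes \<open>1 / p\<close> and the absolute value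
  of \<open>k + 1\<close>.\<close>

lemma absv_fact_mult: "absv (fact (p * k) :: 'k) = absv (fact k :: 'k) / p ^ k"
proof (induction k)
  case (Suc k)
  have *: "absv (fact (p * k + r) :: 'k) = absv (fact (p * k) :: 'k)" if "r < p" for r
    using that
  proof (induction r)
    case (Suc r)
    have "\<not> p dvd Suc (p * k + r)"
    proof
      assume "p dvd Suc (p * k + r)"
      hence "p dvd Suc r"
        using dvd_add_right_iff[of p "p * k" "Suc r"] by simp
      thus False
        using Suc.prems by (auto dest: dvd_imp_le)
    qed
    from absv_of_nat_unit[OF this] show ?case
      using Suc by (simp add: absv_mult del: of_nat_Suc)
  qed auto
  have "p * Suc k = Suc (p * k + (p - 1))"
    using p_pos by simp
  hence "(fact (p * Suc k) :: 'k) = of_nat (p * Suc k) * fact (p * k + (p - 1))"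
    by (simp only: fact_Suc)
  thus ?case
    using *[of "p - 1"] p_pos Suc by (simp add: absv_mult absv_p del: of_nat_Suc mult_Suc_right)
qed auto

text \<open>The valuation of \<open>n!\<close> is at most \<open>n - 1\<close>. A factor prime to
  \<open>p\<close> changes nothing, and for \<open>n = p k\<close> the preceding lemma bounds the
  valuation by \<open>k + (k - 1)\<close>, which is at most \<open>n - 1\<close> as
  \<open>p \<ge> 2\<close>.\<close>

lemma absv_fact_ge: "n > 0 \<Longrightarrow> absv (fact n :: 'k) \<ge> 1 / p ^ (n - 1)"
proof (induction n rule: less_induct)
  case (less n)
  show ?case
  proof (cases "p dvd n")
    case False
    show ?thesis
    proof (cases "n = 1")
      case n: False
      have "absv (fact n :: 'k) = absv (fact (n - 1) :: 'k)"
        using False less.prems absv_of_nat_unit[OF False]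
        by (subst fact_reduce) (auto simp: absv_mult)
      moreover have "\<dots> \<ge> 1 / p ^ (n - 1 - 1)"
        using n less.prems by (intro less.IH) auto
      moreover have "1 / real p ^ (n - 1 - 1) \<ge> 1 / p ^ (n - 1)"
        using p_gt_1 by (intro divide_left_mono power_increasing) auto
      ultimately show ?thesis unfolding of_nat_power by linarith
    qed auto
  next
    case True
    then obtain k where n: "n = p * k" by blast
    with less.prems have k: "k > 0" by auto
    have *: "k - 1 + k \<le> n - 1"
      using mult_right_mono[OF p_ge_2, of k] k unfolding n by linarith
    have "k < n" using k p_gt_1 by (simp add: n)
    have "1 / real p ^ (n - 1) \<le> 1 / real p ^ (k - 1 + k)"
      using p_gt_1 * by (intro divide_left_mono power_increasing) auto
    also have "\<dots> = 1 / real p ^ (k - 1) / p ^ k"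
      by (simp add: power_add)
    also have "\<dots> \<le> absv (fact k :: 'k) / p ^ k"
      using k less.IH[OF \<open>k < n\<close>] by (intro divide_right_mono) auto
    finally show ?thesis
      by (simp add: n absv_fact_mult)
  qed
qed

end

section \<open>The Artin--Hasse exponential\<close>

text \<open>The quotient of two solutions of \<open>Y' = Y H\<close> has derivative 0, hence is the
  constant 1 by the common initial value.\<close>

lemma fps_deriv_linear_unique:
  fixes F G H :: "'a::field_char_0 fps"
  assumes "fps_deriv F = F * H" "fps_deriv G = G * H" "fps_nth F 0 = fps_nth G 0" "fps_nth G 0 \<noteq> 0"
  shows "F = G"
proof -
  have G: "G * inverse G = 1"
    using assms(4) by (simp add: inverse_mult_eq_1')
  have "fps_deriv (F * inverse G) = F * H * inverse G - F * H * inverse G * (G * inverse G)"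
    using assms(4) by (simp add: assms(1,2) fps_inverse_deriv power2_eq_square algebra_simps)
  also have "\<dots> = 0"
    by (simp add: G)
  finally have "fps_deriv (F * inverse G) = 0" .
  hence "F * inverse G = fps_const (fps_nth (F * inverse G) 0)"
    using fps_deriv_eq_0_iff by blast
  also have "\<dots> = 1"
    using assms(3,4) by (simp add: fps_mult_nth)
  finally have "F * inverse G = 1" .
  thus ?thesis
    using G by (metis mult.assoc mult.commute mult_1)
qed

section \<open>Formal exponentials of power series\<close>

definition fps_exp_of :: "'a::field_char_0 fps \<Rightarrow> 'a fps" where
  "fps_exp_of A = fps_exp 1 oo A"

lemma fps_exp_of_nth_0 [simp]: "fps_nth (fps_exp_of A) 0 = 1"
  by (simp add: fps_exp_of_def)

lemma fps_exp_of_0 [simp]: "fps_exp_of 0 = 1"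
  by (simp add: fps_exp_of_def)

lemma fps_deriv_exp_of:
  "fps_nth A 0 = 0 \<Longrightarrow> fps_deriv (fps_exp_of A) = fps_exp_of A * fps_deriv A"
  by (simp add: fps_exp_of_def fps_compose_deriv)

lemma fps_exp_of_add:
  assumes "fps_nth A 0 = 0" "fps_nth B 0 = 0"
  shows "fps_exp_of (A + B) = fps_exp_of A * fps_exp_of B"
  by (rule fps_deriv_linear_unique[where H = "fps_deriv A + fps_deriv B"])
     (use assms in \<open>auto simp: fps_deriv_exp_of algebra_simps\<close>)

lemma fps_exp_of_sum:
  "(\<And>i. i \<in> I \<Longrightarrow> fps_nth (A i) 0 = 0) \<Longrightarrow>
     fps_exp_of (\<Sum>i\<in>I. A i) = (\<Prod>i\<in>I. fps_exp_of (A i))"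
  by (induction I rule: infinite_finite_induct) (auto simp: fps_exp_of_add fps_sum_nth)

lemma fps_exp_of_of_nat_mult:
  "fps_nth A 0 = 0 \<Longrightarrow> fps_exp_of (of_nat n * A) = fps_exp_of A ^ n"
  using fps_exp_of_sum[of "{..<n}" "\<lambda>_. A"] by simp

lemma fps_exp_of_compose:
  "fps_nth A 0 = 0 \<Longrightarrow> fps_nth B 0 = 0 \<Longrightarrow> fps_exp_of A oo B = fps_exp_of (A oo B)"
  by (simp add: fps_exp_of_def fps_compose_assoc)

text \<open>As the constant terms are 1, the \<open>n\<close>-th coefficient of a
  \<open>k\<close>-th power depends on the \<open>n\<close>-th coefficient of the base linearly with
  slope \<open>k\<close>. In Dwork's argument \<open>A\<close> is a series and \<open>B\<close> its
  truncation below \<open>n\<close>.\<close>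

lemma fps_power_nth_diff:
  fixes A B :: "'a::comm_ring_1 fps"
  assumes "\<And>i. i < n \<Longrightarrow> fps_nth A i = fps_nth B i" "fps_nth A 0 = 1" "fps_nth B 0 = 1" "n > 0"
  shows "(\<forall>i<n. fps_nth (A ^ k) i = fps_nth (B ^ k) i) \<and>
         fps_nth (A ^ k) n - fps_nth (B ^ k) n = of_nat k * (fps_nth A n - fps_nth B n)"
proof (induction k)
  case (Suc k)
  have 0: "fps_nth (A ^ k) 0 = 1" "fps_nth (B ^ k) 0 = 1"
    using assms(2,3) by (simp_all add: fps_power_zeroth)
  have expand: "fps_nth (F * G) n = fps_nth F 0 * fps_nth G n + fps_nth F n * fps_nth G 0 +
                  (\<Sum>i\<in>{0<..<n}. fps_nth F i * fps_nth G (n - i))" for F G :: "'a fps"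
  proof -
    have "{0..n} = insert 0 (insert n {0<..<n})"
      using assms(4) by auto
    thus ?thesis
      using assms(4) by (simp add: fps_mult_nth add_ac)
  qed
  have "fps_nth (A ^ Suc k) i = fps_nth (B ^ Suc k) i" if "i < n" for i
    using that assms(1) Suc by (auto simp: fps_mult_nth intro!: sum.cong)
  moreover have "(\<Sum>i\<in>{0<..<n}. fps_nth A i * fps_nth (A ^ k) (n - i)) =
                 (\<Sum>i\<in>{0<..<n}. fps_nth B i * fps_nth (B ^ k) (n - i))"
    using assms(1) Suc by (intro sum.cong) auto
  hence "fps_nth (A ^ Suc k) n - fps_nth (B ^ Suc k) n =
           of_nat (Suc k) * (fps_nth A n - fps_nth B n)"
    using Suc assms(2,3) 0 by (simp add: expand algebra_simps)
  ultimately show ?case by blast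
qed auto

text \<open>This is the sum of \<open>X^(p^i) / p^i\<close>, the logarithm of the Artin-Hasse
  series.\<close>

definition ah_log :: "nat \<Rightarrow> 'a::field_char_0 fps" where
  "ah_log p = Abs_fps (\<lambda>n. if \<exists>i. n = p ^ i then 1 / of_nat n else 0)"

lemma artin_hasse_eq: "artin_hasse p = fps_exp_of (ah_log p)"
  by (simp add: artin_hasse_def fps_exp_of_def ah_log_def)

text \<open>Rationality of the coefficients is what later permits Fermat's congruence for
  them.\<close>

lemma fps_power_nth_in_Rats:
  "(\<And>n. fps_nth A n \<in> \<rat>) \<Longrightarrow> fps_nth (A ^ k) n \<in> (\<rat> :: 'a::field_char_0 set)"
proof (induction k arbitrary: n)
  case (Suc k)
  thus ?case by (auto simp: fps_mult_nth intro!: Rats_sum Rats_mult)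
qed (auto simp: fps_one_nth)

lemma artin_hasse_in_Rats: "fps_nth (artin_hasse p) n \<in> (\<rat> :: 'a::field_char_0 set)"
proof -
  have "fact i \<in> (\<rat> :: 'a set)" for i
    by (metis Rats_of_nat of_nat_fact)
  thus ?thesis
    unfolding artin_hasse_def fps_compose_nth
    by (intro Rats_sum Rats_mult fps_power_nth_in_Rats) auto
qed

section \<open>Integrality of the Artin-Hasse coefficients\<close>

context Cp
begin

lemma ah_log_nth_0: "fps_nth (ah_log p) 0 = (0 :: 'k)"
  using p_pos by (simp add: ah_log_def)

text \<open>Substituting \<open>X ^ p\<close> shifts the index in the sum of
  \<open>X^(p^i) / p^i\<close>: the result is \<open>p\<close> times the terms with
  \<open>i \<ge> 1\<close>, so only the term for \<open>i = 0\<close> is removed.\<close>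

lemma ah_log_compose_power:
  "ah_log p oo fps_X ^ p = of_nat p * ah_log p - (of_nat p * fps_X :: 'k fps)"
proof (rule fps_ext)
  fix n
  have *: "(\<exists>i. p * m = p ^ i) \<longleftrightarrow> (\<exists>i. m = p ^ i)" if "p * m \<noteq> 1" for m
  proof
    assume "\<exists>i. p * m = p ^ i"
    then obtain i where i: "p * m = p ^ i" by blast
    with that obtain j where "i = Suc j" by (cases i) auto
    with i p_pos show "\<exists>i. m = p ^ i" by auto
  next
    assume "\<exists>i. m = p ^ i"
    thus "\<exists>i. p * m = p ^ i" by (metis power_Suc)
  qed
  have **: "p dvd n" if "n = p ^ i" "n \<noteq> 1" for i
    using that by (cases i) auto
  have "fps_nth (ah_log p oo fps_X ^ p) n =
        (if p dvd n then fps_nth (ah_log p) (n div p) else (0 :: 'k))"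
    using p_pos by (subst fps_nth_compose_X_power) auto
  also have "\<dots> = of_nat p * fps_nth (ah_log p) n - of_nat p * (if n = 1 then 1 else 0)"
  proof (cases "p dvd n")
    case True
    then obtain m where m: "n = p * m" by blast
    moreover have "p * m \<noteq> 1" using p_gt_1 by auto
    ultimately show ?thesis
      using p_pos *[of m] by (auto simp: ah_log_def)
  next
    case False
    hence "n \<noteq> 0" using dvd_0_right by metis
    moreover have "(\<exists>i. n = p ^ i) \<longleftrightarrow> n = 1"
      using **[of _] False by (metis power_0)
    ultimately show ?thesis
      using False by (simp add: ah_log_def)
  qed
  finally show "fps_nth (ah_log p oo fps_X ^ p) n =
                fps_nth (of_nat p * ah_log p - (of_nat p * fps_X :: 'k fps)) n"
    by (simp add: fps_of_nat[symmetric] fps_X_def del: fps_of_nat)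
qed

lemma artin_hasse_functional_equation:
  "artin_hasse p oo fps_X ^ p = artin_hasse p ^ p * fps_exp (- of_nat p :: 'k)"
proof -
  have "artin_hasse p oo fps_X ^ p = fps_exp_of (of_nat p * ah_log p + - (of_nat p * fps_X :: 'k fps))"
    using p_pos by (simp add: artin_hasse_eq fps_exp_of_compose ah_log_nth_0 ah_log_compose_power)
  also have "\<dots> = artin_hasse p ^ p * fps_exp_of (- (of_nat p * fps_X))"
    by (subst fps_exp_of_add) (simp_all add: ah_log_nth_0 fps_exp_of_of_nat_mult artin_hasse_eq)
  also have "- (of_nat p * fps_X :: 'k fps) = fps_const (- of_nat p) * fps_X"
    by (simp add: fps_of_nat flip: fps_const_neg)
  also have "fps_exp_of \<dots> = fps_exp (- of_nat p)"
    unfolding fps_exp_of_def by (simp add: fps_compose_linear fps_eq_iff)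
  finally show ?thesis .
qed

text \<open>The valuation of \<open>p ^ n / n!\<close> is at least
  \<open>n - (n - 1) = 1\<close>.\<close>

lemma absv_exp_p_le:
  assumes "n > 0"
  shows "absv (fps_nth (fps_exp (- of_nat p :: 'k)) n) \<le> 1 / p"
proof -
  have "absv (fps_nth (fps_exp (- of_nat p :: 'k)) n) = (1 / p ^ n) / absv (fact n :: 'k)"
    by (simp add: absv_divide absv_power absv_p power_divide)
  also have "\<dots> \<le> (1 / p ^ n) / (1 / p ^ (n - 1))"
    using absv_fact_ge[OF assms] p_pos by (intro divide_left_mono) auto
  also have "\<dots> = 1 / p"
    using assms p_pos by (cases n) auto
  finally show ?thesis .
qed

lemma fps_freshman:
  assumes "fps_le 1 (A :: 'k fps)" "fps_le 1 B"
  shows "fps_le (1 / p) ((A + B) ^ p - (A ^ p + B ^ p))"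
proof -
  have nat: "fps_le 1 (of_nat k :: 'k fps)" for k
    by (simp add: fps_of_nat[symmetric] fps_le_const absv_of_nat_le_1 del: fps_of_nat)
  have pow: "fps_le 1 (C ^ k)" if "fps_le 1 C" for C :: "'k fps" and k
    using fps_le_power[OF that, of k] by simp
  have mult: "fps_le 1 (C * D)" if "fps_le 1 C" "fps_le 1 D" for C D :: "'k fps"
    using fps_le_mult[OF that] by simp
  have p: "fps_le (1 / p) (of_nat p :: 'k fps)"
    by (simp add: fps_of_nat[symmetric] fps_le_const absv_p del: fps_of_nat)
  have "fps_le (1 / p * 1)
          (of_nat p * (\<Sum>k=1..<p. of_nat ((p choose k) div p) * (A ^ k * B ^ (p - k))))"
    using assms by (intro fps_le_mult[OF p] fps_le_sum mult nat pow) auto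
  thus ?thesis
    unfolding binomial_prime_power[OF prime_p] by simp
qed

text \<open>The subtracted sum is the truncation \<open>T\<close> with \<open>X ^ p\<close>
  substituted for \<open>X\<close>, so this is \<open>T(X)^p = T(X^p)\<close> modulo
  \<open>p\<close>. Peeling off the top term uses the binomial congruence and Fermat's congruence
  for its rational coefficient.\<close>

lemma fps_cutoff_freshman:
  assumes "\<And>i. i < n \<Longrightarrow> fps_nth F i \<in> \<rat>" "\<And>i. i < n \<Longrightarrow> absv (fps_nth F i :: 'k) \<le> 1"
  shows "fps_le (1 / p) (fps_cutoff n F ^ p - (\<Sum>i<n. fps_const (fps_nth F i) * fps_X ^ (i * p)))"
  using assms
proof (induction n)
  case 0
  thus ?case using p_pos by (simp add: power_0_left fps_le_def)
next
  case (Suc n)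
  let ?c = "fps_nth F n"
  have split: "fps_cutoff (Suc n) F = fps_cutoff n F + fps_const ?c * fps_X ^ n"
    by (rule fps_ext) (auto simp: less_Suc_eq)
  have "fps_le 1 (fps_cutoff n F)" "fps_le 1 (fps_const ?c * fps_X ^ n)"
    using Suc.prems by (auto simp: fps_le_def)
  note * = fps_freshman[OF this]
  have "absv (?c ^ p - ?c) \<le> 1 / p"
    using Suc.prems by (intro absv_fermat_rat) auto
  hence **: "fps_le (1 / p) (fps_const (?c ^ p - ?c) * fps_X ^ (n * p))"
    by (auto simp: fps_le_def)
  have pow: "(fps_const ?c * fps_X ^ n) ^ p = fps_const (?c ^ p) * fps_X ^ (n * p)"
    by (simp add: power_mult_distrib power_mult fps_const_power)
  have "fps_le (1 / p)
     (((fps_cutoff n F + fps_const ?c * fps_X ^ n) ^ p -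
         (fps_cutoff n F ^ p + (fps_const ?c * fps_X ^ n) ^ p)) +
      ((fps_cutoff n F ^ p - (\<Sum>i<n. fps_const (fps_nth F i) * fps_X ^ (i * p))) +
       fps_const (?c ^ p - ?c) * fps_X ^ (n * p)))"
    using Suc.prems by (intro fps_le_add[OF *] fps_le_add[OF Suc.IH **]) auto
  also have "(((fps_cutoff n F + fps_const ?c * fps_X ^ n) ^ p -
         (fps_cutoff n F ^ p + (fps_const ?c * fps_X ^ n) ^ p)) +
      ((fps_cutoff n F ^ p - (\<Sum>i<n. fps_const (fps_nth F i) * fps_X ^ (i * p))) +
       fps_const (?c ^ p - ?c) * fps_X ^ (n * p))) =
    fps_cutoff (Suc n) F ^ p - (\<Sum>i<Suc n. fps_const (fps_nth F i) * fps_X ^ (i * p))"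
    unfolding split pow by (simp add: algebra_simps flip: fps_const_sub)
  finally show ?case .
qed

text \<open>
  Dwork's criterion: comparing the \<open>n\<close>-th coefficients of \<open>E(X\<^sup>p) = E(X)\<^sup>p exp(-pX)\<close> modulo \<open>p\<close>
  expresses \<open>p e\<^sub>n\<close> through earlier coefficients.
\<close>

lemma absv_artin_hasse_le_1: "absv (fps_nth (artin_hasse p) n :: 'k) \<le> 1"
proof (induction n rule: less_induct)
  case (less n)
  define E where "E = (artin_hasse p :: 'k fps)"
  define T where "T = fps_cutoff n E"
  define e where "e = (fps_exp (- of_nat p) :: 'k fps)"
  have E0: "fps_nth E 0 = 1"
    by (simp add: E_def artin_hasse_eq)
  show ?case
  proof (cases "n = 0")
    case True
    thus ?thesis by (simp add: artin_hasse_eq)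
  next
    case n: False
    have le: "absv (fps_nth E i) \<le> 1" if "i < n" for i
      using less that by (simp add: E_def)
    have T0: "fps_nth T 0 = 1"
      using n by (simp add: T_def E0)
    have T_le: "fps_le 1 (T ^ p)"
      using fps_le_power[of 1 T p] le by (simp add: T_def fps_le_def)
    \<comment> \<open>Passing to the truncation isolates the unknown coefficient: it enters the
      \<open>n\<close>-th coefficient of \<open>E ^ p\<close> only as \<open>p\<close> times
      itself.\<close>
    have *: "(\<forall>i<n. fps_nth (E ^ p) i = fps_nth (T ^ p) i) \<and>
         fps_nth (E ^ p) n - fps_nth (T ^ p) n = of_nat p * (fps_nth E n - fps_nth T n)"
      using n by (intro fps_power_nth_diff) (auto simp: T_def E0)
    have "fps_nth (E ^ p * e) n = fps_nth (E ^ p) n * fps_nth e 0 +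
            (\<Sum>i<n. fps_nth (E ^ p) i * fps_nth e (n - i))"
    proof -
      have "{0..n} = insert n {..<n}" by auto
      thus ?thesis by (simp add: fps_mult_nth)
    qed
    also have "(\<Sum>i<n. fps_nth (E ^ p) i * fps_nth e (n - i)) =
               (\<Sum>i<n. fps_nth (T ^ p) i * fps_nth e (n - i))"
      using * by (intro sum.cong) auto
    finally have 1: "fps_nth (E ^ p * e) n = fps_nth (T ^ p) n + of_nat p * fps_nth E n +
                       (\<Sum>i<n. fps_nth (T ^ p) i * fps_nth e (n - i))"
      using * by (simp add: e_def T_def algebra_simps)
    have 2: "absv (\<Sum>i<n. fps_nth (T ^ p) i * fps_nth e (n - i)) \<le> 1 / p"
    proof (rule absv_sum_le)
      fix i assume "i \<in> {..<n}"
      hence "absv (fps_nth (T ^ p) i) * absv (fps_nth e (n - i)) \<le> 1 * (1 / p)"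
        using T_le absv_exp_p_le[of "n - i"]
        by (intro mult_mono) (auto simp: fps_le_def e_def simp del: fps_exp_nth)
      thus "absv (fps_nth (T ^ p) i * fps_nth e (n - i)) \<le> 1 / p"
        by (simp add: absv_mult)
    qed auto
    \<comment> \<open>\<open>S\<close> is \<open>T\<close> with \<open>X ^ p\<close> substituted. It
      has the same \<open>n\<close>-th coefficient as \<open>E(X^p)\<close>: if \<open>p\<close>
      divides \<open>n\<close>, that coefficient is the one of \<open>E\<close> at
      \<open>n div p\<close>, which is below \<open>n\<close>; otherwise it is 0.\<close>
    define S where "S = (\<Sum>i<n. fps_const (fps_nth E i) * fps_X ^ (i * p))"
    have S: "fps_nth (E oo fps_X ^ p) n = fps_nth S n"
    proof -
      have "fps_nth S n = (\<Sum>i<n. if n = i * p then fps_nth E i else 0)"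
        unfolding S_def fps_sum_nth by (intro sum.cong) auto
      also have "\<dots> = (if p dvd n then fps_nth E (n div p) else 0)"
      proof (cases "p dvd n")
        case True
        then obtain m where m: "n = m * p" by (metis dvd_def mult.commute)
        hence "m < n" using n p_gt_1 by auto
        have "(\<Sum>i<n. if n = i * p then fps_nth E i else 0) =
              (\<Sum>i<n. if i = m then fps_nth E i else 0)"
          using p_pos by (intro sum.cong) (auto simp: m)
        thus ?thesis using \<open>m < n\<close> p_pos by (simp add: m)
      qed (auto intro!: sum.neutral)
      also have "\<dots> = fps_nth (E oo fps_X ^ p) n"
        using p_pos by (subst fps_nth_compose_X_power) auto
      finally show ?thesis ..
    qed
    have 3: "absv (fps_nth (T ^ p - S) n) \<le> 1 / p"
      using fps_cutoff_freshman[of n E] le artin_hasse_in_Rats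
      by (auto simp: fps_le_def T_def S_def E_def)
    have "fps_nth S n = fps_nth (E ^ p * e) n"
      using artin_hasse_functional_equation S by (simp add: E_def e_def)
    hence "of_nat p * fps_nth E n = - (fps_nth (T ^ p - S) n +
             (\<Sum>i<n. fps_nth (T ^ p) i * fps_nth e (n - i)))"
      using 1 by (simp add: algebra_simps)
    also have "absv \<dots> \<le> 1 / p"
      unfolding absv_minus by (intro absv_add_le 2 3)
    finally show ?thesis
      using p_pos by (simp add: absv_mult absv_p E_def divide_simps)
  qed
qed

end

section \<open>Products of values of the splitting function\<close>

locale Dwork = Cp p K for p and K :: "'k::nonarch_closed_field itself" +
  fixes \<gamma> :: 'k
  assumes dwork_root: "is_dwork_root p \<gamma>"
begin

lemma \<gamma>_sums: "(\<lambda>i. \<gamma> ^ (p ^ i) / of_nat (p ^ i)) sums 0"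
  using dwork_root by (simp add: is_dwork_root_def)

lemma \<gamma>_nonzero: "\<gamma> \<noteq> 0"
  using dwork_root p_gt_1 by (auto simp: is_dwork_root_def ordp_def log_def)

lemma absv_\<gamma>_power: "absv \<gamma> ^ (p - 1) = 1 / p"
proof -
  have "log p (absv \<gamma>) = - (1 / (real p - 1))"
    using dwork_root by (simp add: is_dwork_root_def ordp_def)
  hence "absv \<gamma> = p powr (- (1 / (real p - 1)))"
    using \<gamma>_nonzero p_gt_1 by (metis absv_pos_iff powr_log_cancel of_nat_1 of_nat_0 of_nat_less_iff p_pos order.strict_iff_order)
  hence "absv \<gamma> ^ (p - 1) = p powr (- (1 / (real p - 1)) * (p - 1))"
    using p_gt_1 by (simp add: powr_powr flip: powr_realpow)
  also have "- (1 / (real p - 1)) * (p - 1) = -1"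
    using p_gt_1 by (simp add: of_nat_diff field_simps)
  finally show ?thesis
    using p_gt_1 by (simp add: powr_minus divide_inverse)
qed

lemma absv_\<gamma>_less_1: "absv \<gamma> < 1"
proof (rule ccontr)
  assume "\<not> ?thesis"
  hence "absv \<gamma> ^ (p - 1) \<ge> 1" by (intro one_le_power) simp
  thus False using p_gt_1 unfolding absv_\<gamma>_power by simp
qed

text \<open>Bernoulli's inequality gives \<open>p ^ i \<ge> 1 + i (p - 1)\<close>, and each block of
  \<open>p - 1\<close> factors contributes \<open>1 / p\<close>. Hence every
  \<open>\<gamma>^(p^i) / p^i\<close> is bounded by \<open>absv \<gamma>\<close>.\<close>

lemma absv_\<gamma>_p_power: "real (p ^ i) * absv \<gamma> ^ (p ^ i) \<le> absv \<gamma>"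
proof -
  have "1 + real i * (real p - 1) \<le> (1 + (real p - 1)) ^ i"
    using p_gt_1 by (intro Bernoulli_inequality) auto
  also have "real i * (real p - 1) = real (i * (p - 1))"
    using p_gt_1 by (simp add: of_nat_diff)
  finally have "real (1 + i * (p - 1)) \<le> real (p ^ i)"
    by simp
  hence "1 + i * (p - 1) \<le> p ^ i"
    by (simp only: of_nat_le_iff)
  hence "absv \<gamma> ^ (p ^ i) \<le> absv \<gamma> ^ (1 + i * (p - 1))"
    using absv_\<gamma>_less_1 by (intro power_decreasing) auto
  also have "\<dots> = absv \<gamma> * (absv \<gamma> ^ (p - 1)) ^ i"
    by (simp only: power_add power_one_right mult.commute[of i] power_mult)
  also have "\<dots> = absv \<gamma> / p ^ i"
    unfolding absv_\<gamma>_power by (simp add: power_divide)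
  finally show ?thesis
    using p_pos by (simp add: field_simps)
qed

text \<open>The point \<open>t\<close> moves into the coefficients, so that
  \<open>theta p \<gamma> t\<close> is the value at 1 and products of values become products of
  formal series.\<close>

definition ah_scaled :: "'k \<Rightarrow> 'k fps" where
  "ah_scaled t = artin_hasse p oo (fps_const (\<gamma> * t) * fps_X)"

definition log_scaled :: "'k \<Rightarrow> 'k fps" where
  "log_scaled t = ah_log p oo (fps_const (\<gamma> * t) * fps_X)"

lemma ah_scaled_eq: "ah_scaled t = fps_exp_of (log_scaled t)"
  by (simp add: ah_scaled_def log_scaled_def artin_hasse_eq fps_exp_of_compose ah_log_nth_0)

lemma ah_scaled_nth: "fps_nth (ah_scaled t) n = fps_nth (artin_hasse p) n * (\<gamma> * t) ^ n"
  unfolding ah_scaled_def fps_compose_linear by simp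

lemma log_scaled_nth: "fps_nth (log_scaled t) n = fps_nth (ah_log p) n * (\<gamma> * t) ^ n"
  unfolding log_scaled_def fps_compose_linear by simp

lemma theta_eq_ev1: "theta p \<gamma> t = fps_ev1 (ah_scaled t)"
  unfolding theta_def fps_ev1_def ah_scaled_nth[abs_def] ..

lemma fps_null_ah_scaled:
  assumes "absv t \<le> 1"
  shows "fps_null (ah_scaled t)"
  unfolding fps_null_def
proof (rule tendsto_0_absv_le)
  show "(\<lambda>n. absv \<gamma> ^ n) \<longlonglongrightarrow> 0"
    using absv_\<gamma>_less_1 by (intro LIMSEQ_power_zero) auto
  fix n
  have "absv (fps_nth (artin_hasse p) n :: 'k) * (absv \<gamma> ^ n * absv t ^ n) \<le> 1 * (absv \<gamma> ^ n * 1)"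
    using absv_artin_hasse_le_1 assms by (intro mult_mono) (auto simp: power_le_one)
  thus "absv (fps_nth (ah_scaled t) n) \<le> absv \<gamma> ^ n"
    by (simp add: ah_scaled_nth absv_mult absv_power power_mult_distrib)
qed

text \<open>Since \<open>h\<close> vanishes at 1, every partial sum \<open>S M\<close> of the
  exponential series with \<open>M > 0\<close> has value 1. The bound on \<open>h\<close> outweighs
  the factorials: the term of order \<open>m\<close> is at most \<open>absv \<gamma> ^ m\<close> in
  all coefficients at once, so the remainder tends to 0 uniformly and so does its value at
  1.\<close>

lemma fps_exp_of_small:
  fixes h :: "'k fps"
  assumes null: "fps_null h" and small: "fps_le (absv \<gamma> / p) h" and h0: "fps_nth h 0 = 0"
    and ev: "fps_ev1 h = 0"
  shows "fps_null (fps_exp_of h)" "fps_ev1 (fps_exp_of h) = 1"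
proof -
  define S where "S = (\<lambda>M. \<Sum>m<M. fps_const (1 / fact m) * h ^ m)"
  have bnd: "absv (1 / fact m * fps_nth (h ^ m) n) \<le> absv \<gamma> ^ m" for m n
  proof -
    have "absv (fact m :: 'k) \<ge> 1 / p ^ m"
    proof (cases "m = 0")
      case False
      have "1 / real p ^ m \<le> 1 / real p ^ (m - 1)"
        using p_gt_1 by (intro divide_left_mono power_increasing) auto
      thus ?thesis using absv_fact_ge[of m] False by simp
    qed auto
    hence "1 / absv (fact m :: 'k) \<le> p ^ m"
      using p_pos by (simp add: divide_simps mult.commute)
    moreover have "absv (fps_nth (h ^ m) n) \<le> (absv \<gamma> / p) ^ m"
      using fps_le_power[OF small, of m] by (simp add: fps_le_def)
    ultimately have "1 / absv (fact m :: 'k) * absv (fps_nth (h ^ m) n) \<le> p ^ m * (absv \<gamma> / p) ^ m"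
      by (intro mult_mono) auto
    also have "\<dots> = absv \<gamma> ^ m"
      using p_pos by (simp add: power_divide)
    finally show ?thesis
      by (simp add: absv_mult absv_divide)
  qed
  have nullS: "fps_null (S M)" and evS: "M > 0 \<Longrightarrow> fps_ev1 (S M) = 1" for M
  proof -
    have *: "fps_null (S M) \<and> fps_ev1 (S M) = (\<Sum>m<M. fps_ev1 (fps_const (1 / fact m) * h ^ m))"
      unfolding S_def by (intro fps_null_ev1_sum fps_null_mult fps_null_power null) auto
    thus "fps_null (S M)" by blast
    have "(\<Sum>m<M. fps_ev1 (fps_const (1 / fact m) * h ^ m)) = (\<Sum>m<M. if m = 0 then 1 else 0)"
      by (intro sum.cong) (auto simp: fps_ev1_mult fps_null_power null fps_ev1_power ev)
    thus "fps_ev1 (S M) = 1" if "M > 0"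
      using * that by simp
  qed
  have R: "fps_le (absv \<gamma> ^ M) (fps_exp_of h - S M)" for M
    unfolding fps_le_def
  proof
    fix n
    have "fps_nth (fps_exp_of h) n = (\<Sum>m<Suc (max n M). 1 / fact m * fps_nth (h ^ m) n)"
      unfolding fps_exp_of_def fps_compose_nth
    proof (rule sum.mono_neutral_cong_left)
      show "\<forall>i\<in>{..<Suc (max n M)} - {0..n}. 1 / fact i * fps_nth (h ^ i) n = 0"
        using startsby_zero_power_prefix[OF h0] by auto
    qed auto
    also have "{..<Suc (max n M)} = {..<M} \<union> {M..<Suc (max n M)}"
      by auto
    also have "(\<Sum>m\<in>\<dots>. 1 / fact m * fps_nth (h ^ m) n) =
               fps_nth (S M) n + (\<Sum>m=M..<Suc (max n M). 1 / fact m * fps_nth (h ^ m) n)"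
      by (subst sum.union_disjoint) (auto simp: S_def fps_sum_nth)
    finally have "fps_nth (fps_exp_of h - S M) n =
        (\<Sum>m=M..<Suc (max n M). 1 / fact m * fps_nth (h ^ m) n)"
      by simp
    also have "absv \<dots> \<le> absv \<gamma> ^ M"
    proof (rule absv_sum_le)
      fix m assume "m \<in> {M..<Suc (max n M)}"
      hence "absv \<gamma> ^ m \<le> absv \<gamma> ^ M"
        using absv_\<gamma>_less_1 by (intro power_decreasing) auto
      thus "absv (1 / fact m * fps_nth (h ^ m) n) \<le> absv \<gamma> ^ M"
        using bnd[of m n] by linarith
    qed auto
    finally show "absv (fps_nth (fps_exp_of h - S M) n) \<le> absv \<gamma> ^ M" .
  qed
  have lim: "(\<lambda>M. absv \<gamma> ^ M) \<longlonglongrightarrow> 0"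
    using absv_\<gamma>_less_1 by (intro LIMSEQ_power_zero) auto
  show nullE: "fps_null (fps_exp_of h)"
    unfolding fps_null_def lim_sequentially
  proof (intro allI impI)
    fix e :: real assume e: "e > 0"
    then obtain M where M: "absv \<gamma> ^ M < e"
      using real_arch_pow_inv[OF e absv_\<gamma>_less_1] by blast
    obtain N where N: "\<And>n. n \<ge> N \<Longrightarrow> absv (fps_nth (S M) n) < e"
      using nullS[of M] e by (auto simp: fps_null_def lim_sequentially absv_eq_dist)
    have "absv (fps_nth (S M) n + fps_nth (fps_exp_of h - S M) n) < e" if "n \<ge> N" for n
      using N[OF that] R[of M] M by (intro absv_add_less) (auto simp: fps_le_def intro: le_less_trans)
    thus "\<exists>N. \<forall>n\<ge>N. dist (fps_nth (fps_exp_of h) n) 0 < e"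
      by (auto simp: absv_eq_dist)
  qed
  have "absv (fps_ev1 (fps_exp_of h) - 1) \<le> absv \<gamma> ^ Suc M" for M
  proof -
    have "fps_ev1 (fps_exp_of h) - 1 = fps_ev1 (fps_exp_of h - S (Suc M))"
      by (simp add: fps_ev1_diff nullE nullS evS)
    thus ?thesis
      using absv_fps_ev1_le[OF fps_null_diff[OF nullE nullS] R] by metis
  qed
  hence "absv (fps_ev1 (fps_exp_of h) - 1) \<le> 0"
    by (intro LIMSEQ_le_const[OF LIMSEQ_Suc[OF lim]]) auto
  thus "fps_ev1 (fps_exp_of h) = 1"
    using absv_nonneg[of "fps_ev1 (fps_exp_of h) - 1"] by (simp add: order_antisym)
qed

text \<open>The series is \<open>D\<close> times the sum of \<open>(\<gamma> X)^(p^i) / p^i\<close>.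
  The factor \<open>D\<close> supplies the \<open>1 / p\<close> used to exponentiate termwise, and
  the equation defining \<open>\<gamma>\<close> makes the value at 1 vanish.\<close>

lemma
  assumes "absv D \<le> 1 / p"
  shows log_scaled_small: "fps_le (absv \<gamma> / p) (fps_const D * log_scaled 1)"
    and fps_null_log_scaled: "fps_null (fps_const D * log_scaled 1)"
    and fps_ev1_log_scaled: "fps_ev1 (fps_const D * log_scaled 1) = 0"
proof -
  have eq: "fps_nth (fps_const D * log_scaled 1) n =
              (if \<exists>i. n = p ^ i then D * (\<gamma> ^ n / of_nat n) else 0)" for n
    by (simp add: log_scaled_nth ah_log_def)
  have absv_pow: "absv (of_nat (p ^ i) :: 'k) = 1 / p ^ i" for i
    by (simp add: absv_power absv_p power_divide)
  have bound: "absv (fps_nth (fps_const D * log_scaled 1) n) \<le> 1 / p * (real n * absv \<gamma> ^ n)" for n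
  proof (cases "\<exists>i. n = p ^ i")
    case True
    then obtain i where i: "n = p ^ i" by blast
    have "absv D * (absv \<gamma> ^ n * n) \<le> 1 / p * (absv \<gamma> ^ n * n)"
      using assms by (intro mult_right_mono) auto
    thus ?thesis
      using True unfolding eq by (simp add: absv_mult absv_divide absv_power i absv_p power_divide mult_ac)
  qed (simp del: fps_mult_left_const_nth add: eq)
  show "fps_le (absv \<gamma> / p) (fps_const D * log_scaled 1)"
    unfolding fps_le_def
  proof
    fix n
    show "absv (fps_nth (fps_const D * log_scaled 1) n) \<le> absv \<gamma> / p"
    proof (cases "\<exists>i. n = p ^ i")
      case True
      hence "real n * absv \<gamma> ^ n \<le> absv \<gamma>"
        using absv_\<gamma>_p_power by auto
      hence "1 / p * (real n * absv \<gamma> ^ n) \<le> 1 / p * absv \<gamma>"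
        by (intro mult_left_mono) auto
      thus ?thesis using bound[of n] by simp
    qed (simp del: fps_mult_left_const_nth add: eq)
  qed
  show "fps_null (fps_const D * log_scaled 1)"
    unfolding fps_null_def
  proof (rule tendsto_0_absv_le[OF _ bound])
    have "(\<lambda>n. real n * absv \<gamma> ^ n) \<longlonglongrightarrow> 0"
      using powser_times_n_limit_0[of "absv \<gamma>"] absv_\<gamma>_less_1 by simp
    from tendsto_mult_left[OF this, of "1 / p"]
    show "(\<lambda>n. 1 / p * (real n * absv \<gamma> ^ n)) \<longlonglongrightarrow> 0" by simp
  qed
  have mono: "strict_mono (\<lambda>i. p ^ i)"
    using p_gt_1 by (intro strict_monoI power_strict_increasing) auto
  have "(\<lambda>i. D * (\<gamma> ^ (p ^ i) / of_nat (p ^ i))) sums (D * 0)"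
    using tendsto_mult[OF tendsto_const \<gamma>_sums[unfolded sums_def], of D]
    unfolding sums_def by (simp add: sum_distrib_left)
  hence "(\<lambda>i. fps_nth (fps_const D * log_scaled 1) (p ^ i)) sums 0"
    unfolding eq using exI[of "\<lambda>j. p ^ _ = p ^ j"] by auto
  also have "?this \<longleftrightarrow> fps_nth (fps_const D * log_scaled 1) sums 0"
    by (rule sums_mono_reindex[OF mono]) (auto simp: eq simp del: fps_mult_left_const_nth)
  finally show "fps_ev1 (fps_const D * log_scaled 1) = 0"
    by (rule fps_ev1_eqI)
qed

text \<open>
  Formally the left-hand side divided by the right-hand side is \<open>exp(D \<Sum>\<^sub>i (\<gamma>X)\<^bsup>p\<^sup>i\<^esup>/p\<^sup>i)\<close>. As \<open>D\<close> is
  divisible by \<open>p\<close>, here (but not for \<open>\<theta>\<close> itself) the exponential may be evaluated termwise at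
  \<open>X = 1\<close>, where its argument vanishes.
\<close>

lemma prod_theta_eq:
  assumes t: "\<And>i. i \<in> I \<Longrightarrow> absv (t i) \<le> 1" and s: "absv s \<le> 1"
  assumes eq: "\<And>j. (\<Sum>i\<in>I. t i ^ (p ^ j)) - s ^ (p ^ j) = D" and D: "absv D \<le> 1 / p"
  shows "(\<Prod>i\<in>I. theta p \<gamma> (t i)) = theta p \<gamma> s"
proof -
  let ?h = "fps_const D * log_scaled 1"
  have log0: "fps_nth (log_scaled t) 0 = 0" for t
    by (simp add: log_scaled_def ah_log_nth_0)
  \<comment> \<open>Only exponents \<open>n = p ^ j\<close> occur in the logarithms, and there the
    power sums of the \<open>t i\<close> exceed the power of \<open>s\<close> by the same
    \<open>D\<close> for all \<open>j\<close>.\<close>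
  have "(\<Sum>i\<in>I. log_scaled (t i)) = log_scaled s + ?h"
  proof (rule fps_ext)
    fix n
    show "fps_nth (\<Sum>i\<in>I. log_scaled (t i)) n = fps_nth (log_scaled s + ?h) n"
    proof (cases "\<exists>j. n = p ^ j")
      case True
      then obtain j where j: "n = p ^ j" by blast
      have "fps_nth (\<Sum>i\<in>I. log_scaled (t i)) n = fps_nth (ah_log p) n * \<gamma> ^ n * (\<Sum>i\<in>I. t i ^ n)"
        by (simp add: fps_sum_nth log_scaled_nth power_mult_distrib sum_distrib_left mult_ac)
      also have "(\<Sum>i\<in>I. t i ^ n) = s ^ n + D"
        using eq[of j] by (simp add: j algebra_simps)
      finally show ?thesis
        by (simp add: log_scaled_nth power_mult_distrib algebra_simps)
    next
      case False
      hence "fps_nth (log_scaled t) n = 0" for t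
        by (simp add: log_scaled_nth ah_log_def)
      thus ?thesis by (simp add: fps_sum_nth)
    qed
  qed
  hence "(\<Prod>i\<in>I. ah_scaled (t i)) = ah_scaled s * fps_exp_of ?h"
    using fps_exp_of_sum[of I "\<lambda>i. log_scaled (t i)"] log0
    by (simp add: ah_scaled_eq fps_exp_of_add)
  moreover have "fps_ev1 (\<Prod>i\<in>I. ah_scaled (t i)) = (\<Prod>i\<in>I. theta p \<gamma> (t i))"
    using fps_null_ev1_prod[of I "\<lambda>i. ah_scaled (t i)"] fps_null_ah_scaled t
    by (simp add: theta_eq_ev1)
  moreover have "fps_null (fps_exp_of ?h)" "fps_ev1 (fps_exp_of ?h) = 1"
    using fps_exp_of_small[OF fps_null_log_scaled log_scaled_small _ fps_ev1_log_scaled] D log0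
    by simp_all
  ultimately show ?thesis
    by (simp add: fps_ev1_mult fps_null_ah_scaled s theta_eq_ev1)
qed

end

section \<open>Teichmueller lifts\<close>

lemma power_fixed_iterate:
  fixes x :: "'a::monoid_mult"
  assumes "x ^ N = x"
  shows "x ^ (N ^ m) = x"
  by (induction m) (simp_all add: power_mult assms)

text \<open>The \<open>p\<close>-th power map permutes the conjugates cyclically; in the telescoping
  sum, the shifted sum loses \<open>f 0\<close> and gains the equal \<open>f m\<close>.\<close>

lemma sum_conjugates_power:
  fixes x :: "'a::comm_ring_1"
  assumes "x ^ (p ^ m) = x"
  shows "(\<Sum>e<m. (x ^ (p ^ e)) ^ (p ^ j)) = (\<Sum>e<m. x ^ (p ^ e))"
proof (induction j)
  case (Suc j)
  define f where "f e = (x ^ (p ^ e)) ^ (p ^ j)" for e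
  have "(\<Sum>e<m. f (Suc e) - f e) = f m - f 0"
    by (rule sum_lessThan_telescope)
  also have "f m = f 0"
    by (simp add: f_def assms)
  finally have "(\<Sum>e<m. f (Suc e)) = (\<Sum>e<m. f e)"
    by (simp add: sum_subtractf)
  moreover have "f (Suc e) = (x ^ (p ^ e)) ^ (p ^ Suc j)" for e
    by (simp add: f_def mult_ac flip: power_mult)
  ultimately show ?case
    using Suc by (simp add: f_def)
qed auto

locale Teich = Cp p K for p and K :: "'k::nonarch_closed_field itself" +
  fixes red :: "'k \<Rightarrow> 'r::alg_closed_field"
  assumes residue: "is_residue_map red"
begin

lemma red_surj: "\<exists>z. absv z \<le> 1 \<and> red z = x"
  using residue unfolding is_residue_map_def by (metis (mono_tags, lifting) UNIV_I imageE mem_Collect_eq)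

lemma red_add: "absv x \<le> 1 \<Longrightarrow> absv y \<le> 1 \<Longrightarrow> red (x + y) = red x + red y"
  and red_mult: "absv x \<le> 1 \<Longrightarrow> absv y \<le> 1 \<Longrightarrow> red (x * y) = red x * red y"
  and red_1 [simp]: "red 1 = 1"
  and red_eq_0_iff: "absv x \<le> 1 \<Longrightarrow> red x = 0 \<longleftrightarrow> absv x < 1"
  using residue by (auto simp: is_residue_map_def)

lemma red_0 [simp]: "red 0 = 0"
  by (simp add: red_eq_0_iff)

lemma red_diff: "absv x \<le> 1 \<Longrightarrow> absv y \<le> 1 \<Longrightarrow> red (x - y) = red x - red y"
  using red_add[of "x - y" y] by (simp add: absv_diff_le)

lemma red_eq_iff: "absv x \<le> 1 \<Longrightarrow> absv y \<le> 1 \<Longrightarrow> red x = red y \<longleftrightarrow> absv (x - y) < 1"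
  using red_eq_0_iff[of "x - y"] by (simp add: red_diff absv_diff_le)

lemma red_power: "absv x \<le> 1 \<Longrightarrow> red (x ^ n) = red x ^ n"
  by (induction n) (auto simp: red_mult absv_power power_le_one)

lemma red_sum: "(\<And>i. i \<in> A \<Longrightarrow> absv (f i) \<le> 1) \<Longrightarrow> red (sum f A) = (\<Sum>i\<in>A. red (f i))"
  by (induction A rule: infinite_finite_induct) (auto simp: red_add absv_sum_le)

lemma red_of_nat: "red (of_nat n) = of_nat n"
  by (induction n) (auto simp: red_add absv_of_nat_le_1)

lemma of_nat_p_eq_0: "(of_nat p :: 'r) = 0"
  using red_eq_0_iff[of "of_nat p"] p_gt_1 by (simp add: red_of_nat absv_p)

lemma char_r: "CHAR('r) = p"
proof -
  have "CHAR('r) dvd p"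
    using of_nat_p_eq_0 by (simp add: of_nat_eq_0_iff_char_dvd)
  moreover have "CHAR('r) \<noteq> 1" by (metis of_nat_1 of_nat_CHAR zero_neq_one)
  ultimately show ?thesis
    using prime_p by (metis prime_nat_iff)
qed

text \<open>The factor \<open>x - y\<close> splits off, and the cofactor reduces to
  \<open>Q * y^(Q - 1)\<close>, which is 0 in characteristic \<open>p\<close>. So the power map
  strictly shortens distances within a residue class.\<close>

lemma absv_power_diff_less:
  fixes x y :: 'k
  assumes "p dvd Q" "absv x \<le> 1" "absv y \<le> 1" "absv (x - y) < 1" "x \<noteq> y"
  shows "absv (x ^ Q - y ^ Q) < absv (x - y)"
proof -
  let ?S = "\<Sum>i<Q. y ^ (Q - Suc i) * x ^ i"
  have le: "absv (y ^ (Q - Suc i) * x ^ i) \<le> 1" for i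
    using assms by (simp add: absv_mult absv_power power_le_one mult_le_one)
  have "red x = red y"
    using assms by (simp add: red_eq_iff)
  hence "red ?S = (\<Sum>i<Q. red y ^ (Q - Suc i) * red y ^ i)"
    using assms le by (subst red_sum) (auto simp: red_mult red_power absv_power power_le_one)
  also have "\<dots> = (\<Sum>i<Q. red y ^ (Q - 1))"
    by (intro sum.cong) (auto simp flip: power_add)
  also have "\<dots> = 0"
  proof -
    have "(of_nat Q :: 'r) = 0"
      using assms(1) of_nat_p_eq_0 by (auto elim!: dvdE)
    thus ?thesis by simp
  qed
  finally have "absv ?S < 1"
    using le by (subst (asm) red_eq_0_iff) (auto intro: absv_sum_le)
  hence "absv (x - y) * absv ?S < absv (x - y) * 1"
    using assms by (intro mult_strict_left_mono) auto
  thus ?thesis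
    by (simp add: power_diff_sumr2 absv_mult)
qed

definition is_teich :: "'r \<Rightarrow> 'k \<Rightarrow> bool" where
  "is_teich x z \<longleftrightarrow> absv z \<le> 1 \<and> red z = x \<and> (\<exists>m>0. z ^ (p ^ m) = z)"

text \<open>Both lifts are fixed by the power \<open>p^(m * m')\<close>, but that power strictly
  shortens the distance between distinct congruent elements.\<close>

lemma is_teich_unique:
  assumes "is_teich x z" "is_teich x z'"
  shows "z = z'"
proof (rule ccontr)
  assume neq: "z \<noteq> z'"
  from assms obtain m m' where m: "m > 0" "z ^ (p ^ m) = z" "m' > 0" "z' ^ (p ^ m') = z'"
    by (auto simp: is_teich_def)
  have "z ^ (p ^ (m * m')) = z"
    using power_fixed_iterate[OF m(2), of m'] by (simp add: power_mult)
  moreover have "z' ^ (p ^ (m * m')) = z'"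
    using power_fixed_iterate[OF m(4), of m] by (simp add: power_mult mult.commute[of m] flip: power_mult)
  moreover have "absv (z - z') < 1"
    using assms red_eq_iff[of z z'] by (simp add: is_teich_def)
  ultimately show False
    using absv_power_diff_less[of "p ^ (m * m')" z z'] neq assms m(1,3)
    by (auto simp: is_teich_def)
qed

lemma teich_eqI: "is_teich x z \<Longrightarrow> teich p red x = z"
  unfolding teich_def
  by (rule the_equality) (use is_teich_unique[of x] in \<open>auto simp: is_teich_def\<close>)

text \<open>Algebraic closedness takes the place of Hensel's lemma. For any lift \<open>z0\<close>
  of \<open>x\<close>, the element \<open>z0^Q - z0\<close> has absolute value less than 1 and is
  the product of all \<open>z0 - z\<close> over the roots \<open>z\<close> of
  \<open>X^Q - X\<close>, so some root lies in the residue class of \<open>z0\<close>.\<close>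

lemma teich_exists:
  assumes "x ^ (p ^ m) = x" "m > 0"
  shows "\<exists>z. absv z \<le> 1 \<and> red z = x \<and> z ^ (p ^ m) = z"
proof -
  define Q where "Q = p ^ m"
  have Q: "Q > 1" using assms p_gt_1 by (simp add: Q_def one_less_power del: One_nat_def)
  obtain z0 where z0: "absv z0 \<le> 1" "red z0 = x"
    using red_surj by blast
  define P :: "'k poly" where "P = monom 1 Q + monom (-1) 1"
  have P0: "P \<noteq> 0"
  proof
    assume "P = 0"
    hence "coeff P Q = 0" by simp
    thus False using Q by (simp add: P_def coeff_monom)
  qed
  have poly_P: "poly P z = z ^ Q - z" for z
    by (simp add: P_def poly_monom)
  obtain A where A: "size A = degree P" "P = smult (lead_coeff P) (\<Prod>z\<in>#A. [:-z, 1:])"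
    using alg_closed_imp_factorization[OF P0] by auto
  have lead: "lead_coeff P = 1"
  proof -
    have "degree P = Q"
      unfolding P_def using Q by (subst degree_add_eq_left) (auto simp: degree_monom_eq)
    thus ?thesis using Q by (simp add: P_def coeff_monom)
  qed
  have "red (z0 ^ Q - z0) = 0"
    using z0 assms by (simp add: red_diff absv_power power_le_one red_power Q_def)
  hence "absv (z0 ^ Q - z0) < 1"
    using z0 by (subst (asm) red_eq_0_iff) (auto intro!: absv_diff_le simp: absv_power power_le_one)
  moreover have "absv (\<Prod>z\<in>#A. z0 - z) \<ge> 1" if "\<And>z. z \<in># A \<Longrightarrow> absv (z0 - z) \<ge> 1" for A
    using that
    by (induction A) (auto simp: absv_mult intro!: mult_ge1_I)
  moreover have "z0 ^ Q - z0 = (\<Prod>z\<in>#A. z0 - z)"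
  proof -
    have "poly P z0 = poly (\<Prod>z\<in>#A. [:-z, 1:]) z0"
      using A(2) lead by simp
    thus ?thesis
      by (simp add: poly_P poly_prod_mset image_mset.compositionality o_def)
  qed
  ultimately obtain z where z: "z \<in># A" "absv (z0 - z) < 1"
    by (metis not_less)
  have "poly P z = poly (\<Prod>z\<in>#A. [:-z, 1:]) z"
    using A(2) lead by simp
  also have "\<dots> = 0"
    using z(1) by (auto simp: poly_prod_mset image_mset.compositionality o_def prod_mset_zero_iff)
  finally have root: "z ^ Q = z"
    by (simp add: poly_P)
  have le: "absv z \<le> 1"
    using absv_diff_le[of z0 1 "z0 - z"] z(2) z0 by simp
  moreover have "red z = x"
    using red_eq_iff[of z0 z] z0 le z(2) by auto
  ultimately show ?thesis
    using root by (auto simp: Q_def)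
qed

lemma
  assumes "x ^ (p ^ m) = x" "m > 0"
  shows absv_teich: "absv (teich p red x) \<le> 1"
    and red_teich: "red (teich p red x) = x"
    and teich_power_fixed: "teich p red x ^ (p ^ m) = teich p red x"
proof -
  obtain z where z: "absv z \<le> 1" "red z = x" "z ^ (p ^ m) = z"
    using teich_exists[OF assms] by blast
  hence "is_teich x z"
    using assms(2) by (auto simp: is_teich_def)
  moreover from this have "teich p red x = z" by (rule teich_eqI)
  ultimately show "absv (teich p red x) \<le> 1" "red (teich p red x) = x"
    "teich p red x ^ (p ^ m) = teich p red x"
    using z by auto
qed

lemma teich_1: "teich p red 1 = 1"
  by (rule teich_eqI) (auto simp: is_teich_def intro: exI[of _ 1])

lemma teich_mult:
  assumes "x ^ (p ^ m) = x" "y ^ (p ^ m) = y" "m > 0"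
  shows "teich p red (x * y) = teich p red x * teich p red y"
proof (rule teich_eqI)
  note x = absv_teich[OF assms(1,3)] red_teich[OF assms(1,3)] teich_power_fixed[OF assms(1,3)]
  note y = absv_teich[OF assms(2,3)] red_teich[OF assms(2,3)] teich_power_fixed[OF assms(2,3)]
  show "is_teich (x * y) (teich p red x * teich p red y)"
    unfolding is_teich_def using x y assms(3)
    by (auto simp: absv_mult red_mult power_mult_distrib mult_le_one)
qed

lemma teich_power:
  assumes "x ^ (p ^ m) = x" "m > 0"
  shows "teich p red (x ^ n) = teich p red x ^ n"
proof (induction n)
  case (Suc n)
  have "(x ^ n) ^ (p ^ m) = x ^ n"
    using assms(1) by (metis power_mult mult.commute)
  thus ?case using Suc teich_mult[OF assms(1) _ assms(2)] by simp
qed (auto simp: teich_1)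

lemma teich_powi:
  assumes "x ^ (p ^ m) = x" "m > 0"
  shows "teich p red (x powi n) = teich p red x powi n"
proof -
  have inv: "teich p red (inverse y) = inverse (teich p red y)" if y: "y ^ (p ^ m) = y" for y
  proof (cases "y = 0")
    case True
    have "teich p red 0 = 0"
      by (rule teich_eqI) (use p_pos in \<open>auto simp: is_teich_def power_0_left intro: exI[of _ 1]\<close>)
    thus ?thesis using True by simp
  next
    case False
    have "inverse y ^ (p ^ m) = inverse y"
      using y by (simp add: power_inverse)
    from teich_mult[OF y this assms(2)] show ?thesis
      using False by (simp add: teich_1 inverse_unique)
  qed
  have "inverse x ^ (p ^ m) = inverse x"
    using assms(1) by (simp add: power_inverse)
  from teich_power[OF this assms(2)] show ?thesis
    by (simp add: power_int_def teich_power[OF assms] inv[OF assms(1)])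
qed

lemma teich_prod:
  assumes "\<And>i. i \<in> A \<Longrightarrow> f i ^ (p ^ m) = f i" "m > 0"
  shows "teich p red (\<Prod>i\<in>A. f i) = (\<Prod>i\<in>A. teich p red (f i))"
  using assms
proof (induction A rule: infinite_finite_induct)
  case (insert a A)
  have "(\<Prod>i\<in>A. f i) ^ (p ^ m) = (\<Prod>i\<in>A. f i)"
    unfolding prod_power_distrib using insert.prems by (intro prod.cong) auto
  thus ?case
    using insert teich_mult[of "f a" m "\<Prod>i\<in>A. f i"] by simp
qed (auto simp: teich_1)

text \<open>The map \<open>\<tau>\<close> sends a root of \<open>X^q - X\<close> to another root,
  congruent to the \<open>p\<close>-th power of the first. Uniqueness of Teichmueller
  representatives turns this congruence into an equality.\<close>

lemma frobenius_teich:
  assumes \<tau>: "is_frobenius p (p ^ a) \<tau>" and x: "x ^ (p ^ a) = x" "a > 0"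
  shows "(\<tau> ^^ m) (teich p red x) = teich p red x ^ (p ^ m)"
proof -
  define q where "q = p ^ a"
  define z where "z = teich p red x"
  have q: "q > 1" using assms p_gt_1 by (simp add: q_def one_less_power del: One_nat_def)
  have z: "absv z \<le> 1" "z ^ q = z"
    using absv_teich[OF x] teich_power_fixed[OF x] by (simp_all add: z_def q_def)
  have \<tau>_in: "y \<in> Qq q \<Longrightarrow> \<tau> y \<in> Qq q" for y
    using \<tau> unfolding is_frobenius_def q_def by (meson bij_betwE)
  have \<tau>_mult: "\<tau> (y * w) = \<tau> y * \<tau> w" if "y \<in> Qq q" "w \<in> Qq q" for y w
    using \<tau> that unfolding is_frobenius_def q_def by blast
  have Qq: "is_subfield (Qq q :: 'k set)"
    unfolding Qq_def by (rule hull_in) (fastforce simp: is_subfield_def)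
  have pow_in: "y ^ n \<in> Qq q" if "y \<in> Qq q" for y :: 'k and n
    by (induction n) (use Qq that in \<open>auto simp: is_subfield_def\<close>)
  have \<tau>_1: "\<tau> 1 = 1"
  proof -
    have "1 \<in> (Qp :: 'k set)"
      unfolding Qp_def using closure_subset Rats_1 by blast
    thus ?thesis using \<tau> by (auto simp: is_frobenius_def)
  qed
  have \<tau>_pow: "\<tau> (y ^ n) = \<tau> y ^ n" if "y \<in> Qq q" for y n
    by (induction n) (use that pow_in \<tau>_mult in \<open>auto simp: \<tau>_1\<close>)
  have root_in: "w \<in> Qq q" if "w ^ q = w" for w :: 'k
  proof (cases "w = 0")
    case True
    have "1 - 1 \<in> (Qq q :: 'k set)"
      using Qq unfolding is_subfield_def by blast
    thus ?thesis using True by simp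
  next
    case False
    have "w ^ (q - 1) * w = w ^ q"
      using q by (metis One_nat_def Suc_pred less_trans power_Suc2 zero_less_one)
    hence "w ^ (q - 1) = 1"
      using that False by simp
    thus ?thesis
      unfolding Qq_def by (intro hull_inc) auto
  qed
  have step: "\<tau> w = w ^ p" if w: "w ^ q = w" "absv w \<le> 1" for w
  proof -
    have 1: "\<tau> w ^ q = \<tau> w"
      using \<tau>_pow[OF root_in[OF w(1)], of q] w by simp
    have le: "absv y \<le> 1" if "y ^ q = y" for y :: 'k
    proof (rule ccontr)
      assume "\<not> absv y \<le> 1"
      hence "absv y ^ 1 < absv y ^ q" using q by (intro power_strict_increasing) auto
      thus False using that by (simp flip: absv_power)
    qed
    have 2: "(w ^ p) ^ q = w ^ p"
      using w by (metis power_mult mult.commute)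
    have 3: "absv (\<tau> w - w ^ p) < 1"
      using \<tau> root_in[OF w(1)] w(2) by (auto simp: is_frobenius_def q_def)
    have "is_teich (red (\<tau> w)) (\<tau> w)" "is_teich (red (\<tau> w)) (w ^ p)"
      using 1 2 3 le x(2) red_eq_iff[of "\<tau> w" "w ^ p"] by (auto simp: is_teich_def q_def)
    thus ?thesis by (rule is_teich_unique)
  qed
  have "(\<tau> ^^ m) z = z ^ (p ^ m)"
  proof (induction m)
    case (Suc m)
    have "(z ^ (p ^ m)) ^ q = z ^ (p ^ m)"
      using z by (metis power_mult mult.commute)
    hence "\<tau> (z ^ (p ^ m)) = (z ^ (p ^ m)) ^ p"
      using z by (intro step) (auto simp: absv_power power_le_one)
    thus ?case using Suc by (simp add: mult.commute flip: power_mult)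
  qed auto
  thus ?thesis by (simp add: z_def)
qed

end

section \<open>Traces and the additive character\<close>

lemma sum_lessThan_mult_group:
  fixes f :: "nat \<Rightarrow> 'a::comm_monoid_add"
  shows "(\<Sum>j<n. \<Sum>i<m. f (m * j + i)) = (\<Sum>e<m * n. f e)"
proof -
  have "(\<Sum>i<m. f (m * j + i)) = sum f {j * m..<j * m + m}" for j
    using sum.shift_bounds_nat_ivl[of f 0 "j * m" m]
    by (simp add: atLeast0LessThan mult.commute add.commute)
  thus ?thesis
    by (simp add: sum.nat_group mult.commute)
qed

lemma prod_lessThan_mult_group:
  fixes f :: "nat \<Rightarrow> 'a::comm_monoid_mult"
  shows "(\<Prod>j<n. \<Prod>i<m. f (m * j + i)) = (\<Prod>e<m * n. f e)"
proof -
  have "(\<Prod>i<m. f (m * j + i)) = prod f {j * m..<j * m + m}" for j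
    using prod.shift_bounds_nat_ivl[of f 0 "j * m" m]
    by (simp add: atLeast0LessThan mult.commute add.commute)
  thus ?thesis
    by (simp add: prod.nat_group mult.commute)
qed

locale Dwork_Teich = Dwork p K \<gamma> + Teich p K red
  for p and K :: "'k::nonarch_closed_field itself" and \<gamma> and red :: "'k \<Rightarrow> 'r::alg_closed_field"
begin

lemma frob_sum: "(\<Sum>i\<in>A. f i :: 'r) ^ (p ^ n) = (\<Sum>i\<in>A. f i ^ (p ^ n))"
  using freshmans_dream_sum'[where 'a = 'r, of "p ^ n" n f A] char_r prime_p by simp

lemma ff_trace_tower: "ff_trace p a (ff_trace (p ^ a) n (x::'r)) = ff_trace p (a * n) x"
proof -
  have "ff_trace p a (ff_trace (p ^ a) n x) = (\<Sum>i<a. \<Sum>j<n. x ^ (p ^ (a * j + i)))"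
    by (simp add: ff_trace_def frob_sum power_add power_mult flip: power_mult)
  also have "\<dots> = (\<Sum>j<n. \<Sum>i<a. x ^ (p ^ (a * j + i)))"
    by (rule sum.swap)
  also have "\<dots> = ff_trace p (a * n) x"
    unfolding ff_trace_def by (rule sum_lessThan_mult_group)
  finally show ?thesis .
qed

text \<open>The \<open>t (u, e)\<close> are the conjugates of the lifts. All their
  \<open>p^j\<close>-th power sums equal \<open>T\<close>, while \<open>s\<close> is fixed by the
  \<open>p\<close>-th power, so the difference is \<open>T - s\<close> for every \<open>j\<close>.
  It reduces to 0 and is therefore divisible by \<open>p\<close>, as the product formula for
  \<open>theta\<close> requires.\<close>

lemma Theta_trace_sum:
  assumes U: "finite U" and x: "\<And>u. u \<in> U \<Longrightarrow> x u ^ (p ^ m) = x u" and m: "m > 0"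
  shows "Theta p red \<gamma> (ff_trace p m (\<Sum>u\<in>U. x u)) =
           (\<Prod>u\<in>U. \<Prod>e<m. theta p \<gamma> (teich p red (x u) ^ (p ^ e)))"
proof -
  define z where "z = ff_trace p m (\<Sum>u\<in>U. x u)"
  define s where "s = teich p red z"
  define t where "t = (\<lambda>(u,e). teich p red (x u) ^ (p ^ e))"
  define T where "T = (\<Sum>i\<in>U \<times> {..<m}. t i)"
  have "(\<Sum>u\<in>U. x u) ^ (p ^ m) = (\<Sum>u\<in>U. x u)"
    using x by (simp add: frob_sum)
  \<comment> \<open>The trace lies in the prime field, so its lift is fixed already by the
    \<open>p\<close>-th power.\<close>
  from sum_conjugates_power[OF this, of 1] have "z ^ (p ^ 1) = z"
    unfolding z_def ff_trace_def frob_sum .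
  note s = absv_teich[OF this zero_less_one] red_teich[OF this zero_less_one]
           teich_power_fixed[OF this zero_less_one]
  have t_le: "absv (t i) \<le> 1" if "i \<in> U \<times> {..<m}" for i
    using that absv_teich[OF x m] by (auto simp: t_def absv_power power_le_one)
  have t_pow: "(\<Sum>i\<in>U \<times> {..<m}. t i ^ (p ^ j)) = T" for j
  proof -
    have "(\<Sum>i\<in>U \<times> {..<m}. t i ^ (p ^ j)) =
            (\<Sum>u\<in>U. \<Sum>e<m. (teich p red (x u) ^ (p ^ e)) ^ (p ^ j))"
      by (simp add: sum.cartesian_product t_def case_prod_unfold)
    also have "\<dots> = (\<Sum>u\<in>U. \<Sum>e<m. teich p red (x u) ^ (p ^ e))"
      by (intro sum.cong refl sum_conjugates_power teich_power_fixed x m)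
    also have "\<dots> = T"
      by (simp add: T_def sum.cartesian_product t_def case_prod_unfold)
    finally show ?thesis .
  qed
  have red_t: "red (t (u, e)) = x u ^ (p ^ e)" if "u \<in> U" for u e
    using absv_teich[OF x m] red_teich[OF x m] that by (simp add: t_def red_power)
  have "red T = (\<Sum>(u,e)\<in>U \<times> {..<m}. x u ^ (p ^ e))"
    unfolding T_def using t_le
    by (subst red_sum) (auto simp: red_t intro!: sum.cong)
  also have "\<dots> = (\<Sum>e<m. \<Sum>u\<in>U. x u ^ (p ^ e))"
    by (subst sum.swap) (simp add: sum.cartesian_product)
  also have "\<dots> = red s"
    using s by (simp add: s_def z_def ff_trace_def frob_sum)
  finally have "absv (T - s) < 1"
    using red_eq_iff[of T s] s t_le by (simp add: T_def s_def absv_sum_le)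
  hence D: "absv (T - s) \<le> 1 / p"
    unfolding T_def
    using t_pow[of 1] s t_le U by (intro absv_less_1_imp_le) (auto simp: s_def T_def)
  have "(\<Prod>i\<in>U \<times> {..<m}. theta p \<gamma> (t i)) = theta p \<gamma> s"
  proof (rule prod_theta_eq[OF t_le _ _ D])
    have "s ^ (p ^ j) = s" for j
      using power_fixed_iterate[of s p j] s by (simp add: s_def)
    thus "(\<Sum>i\<in>U \<times> {..<m}. t i ^ (p ^ j)) - s ^ (p ^ j) = T - s" for j
      by (simp add: t_pow)
  qed (use s in \<open>auto simp: s_def\<close>)
  thus ?thesis
    by (simp add: Theta_def z_def s_def t_def prod.cartesian_product case_prod_unfold)
qed

end

section \<open>The twisted torus\<close>

lemma power_powi_commute: "((x::'a::field) ^ m) powi n = (x powi n) ^ m"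
  by (simp add: power_int_def power_inverse mult.commute flip: power_mult)

lemma power_fixed_cong:
  fixes x :: "'a::monoid_mult"
  assumes "x ^ (Q ^ n) = x" "r mod n = s mod n"
  shows "x ^ (Q ^ r) = x ^ (Q ^ s)"
proof -
  have "x ^ (Q ^ r) = x ^ (Q ^ (r mod n))" for r
  proof -
    have "Q ^ r = (Q ^ n) ^ (r div n) * Q ^ (r mod n)"
      by (metis div_mult_mod_eq mult.commute power_add power_mult)
    thus ?thesis
      using power_fixed_iterate[OF assms(1), of "r div n"] by (simp add: power_mult)
  qed
  thus ?thesis using assms(2) by metis
qed

locale twisted_torus =
  fixes q k :: nat and b :: int and d :: "'n::finite \<Rightarrow> nat"
  assumes d_pos: "d i > 0" and coprime_b: "coprime b (int (Lcm (range d)))"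
begin

definition D where "D = Lcm (range d)"

lemma d_dvd_D: "d i dvd D"
  unfolding D_def by (intro dvd_Lcm) auto

lemma D_pos: "D > 0"
proof -
  have "0 \<notin> range d" using d_pos by (metis less_irrefl rangeE)
  thus ?thesis unfolding D_def by (intro Nat.gr0I) (simp add: Lcm_0_iff)
qed

text \<open>The position reached from 0 after \<open>r\<close> shifts by \<open>b\<close> on a cycle
  of length \<open>n\<close>: \<open>n = d i\<close> for the coordinates, \<open>n = D\<close> for
  the index of the product.\<close>

definition step :: "nat \<Rightarrow> nat \<Rightarrow> nat" where
  "step n r = nat ((int r * b) mod int n)"

text \<open>An inverse of \<open>b\<close> modulo \<open>D\<close>, hence modulo each
  \<open>d i\<close>. The right side is \<open>1 mod int D\<close> so as to include
  \<open>D = 1\<close>.\<close>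

definition binv :: nat where
  "binv = (SOME c. (int c * b) mod int D = 1 mod int D)"

lemma binv: "(int binv * b) mod int D = 1 mod int D"
proof -
  obtain u v where "u * b + v * int D = 1"
    using bezout_int[of b "int D"] coprime_b by (auto simp: D_def)
  hence "(u * b) mod int D = 1 mod int D"
    by (metis mod_mult_self2 mult.commute)
  hence "(int (nat (u mod int D)) * b) mod int D = 1 mod int D"
    using D_pos by (simp add: mod_mult_left_eq)
  thus ?thesis
    unfolding binv_def by (rule someI)
qed

lemma binv_d: "(int binv * b) mod int (d i) = 1 mod int (d i)"
  using binv d_dvd_D[of i] by (metis int_dvd_int_iff mod_mod_cancel)

lemma step_less: "step (d i) r < d i"
  using d_pos[of i] by (simp add: step_def nat_less_iff)

lemma step_Suc: "nat ((int (step (d i) r) + b) mod int (d i)) = step (d i) (Suc r)"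
  using d_pos[of i] by (simp add: step_def mod_add_left_eq mod_add_right_eq algebra_simps)

lemma step_binv:
  assumes "j < d i"
  shows "step (d i) (j * binv) = j"
proof -
  have "(int (j * binv) * b) mod int (d i) = (int j * ((int binv * b) mod int (d i))) mod int (d i)"
    by (simp add: mod_mult_right_eq mult_ac)
  also have "\<dots> = int j mod int (d i)"
    by (simp only: binv_d mod_mult_right_eq mult_1_right)
  finally show ?thesis
    using assms by (simp add: step_def)
qed

lemma step_D_mod: "step D r mod d i = step (d i) r"
proof -
  have "int (step D r mod d i) = (int r * b) mod int D mod int (d i)"
    using D_pos by (simp add: step_def zmod_int)
  also have "\<dots> = (int r * b) mod int (d i)"
    using d_dvd_D[of i] by (simp add: mod_mod_cancel)
  also have "\<dots> = int (step (d i) r)"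
    using d_pos[of i] by (simp add: step_def)
  finally show ?thesis by simp
qed

text \<open>Multiplication by \<open>b\<close> is injective modulo \<open>D\<close> by coprimality,
  hence permutes the finitely many residues.\<close>

lemma bij_step_D: "bij_betw (step D) {..<D} {..<D}"
proof -
  have "inj_on (step D) {..<D}"
  proof (rule inj_onI)
    fix r s assume rs: "r \<in> {..<D}" "s \<in> {..<D}" "step D r = step D s"
    have "(int r * b) mod int D = (int s * b) mod int D"
      using arg_cong[OF rs(3), of int] D_pos by (simp add: step_def)
    hence "int D dvd int r * b - int s * b"
      by (simp add: mod_eq_dvd_iff)
    hence "int D dvd (int r - int s) * b"
      by (simp add: left_diff_distrib)
    hence "int D dvd int r - int s"
      using coprime_b by (simp add: coprime_dvd_mult_left_iff coprime_commute D_def)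
    hence "int r mod int D = int s mod int D"
      by (simp add: mod_eq_dvd_iff)
    thus "r = s"
      using rs(1,2) by simp
  qed
  moreover have "step D ` {..<D} \<subseteq> {..<D}"
    using D_pos by (auto simp: step_def nat_less_iff)
  ultimately show ?thesis
    by (simp add: bij_betw_def endo_inj_surj)
qed

section \<open>Points of the twisted torus and their coordinates of index 0\<close>

abbreviation W :: "('n \<times> nat \<Rightarrow> 'r::field) set" where
  "W \<equiv> W_set q d k b"

text \<open>Each use of the defining relation shifts the index by \<open>b\<close> and raises the
  coordinate to the power \<open>q ^ k\<close>.\<close>

lemma W_step:
  assumes "y \<in> W"
  shows "y (i, step (d i) r) = y (i, 0) ^ ((q ^ k) ^ r)"
proof (induction r)
  case 0
  show ?case by (simp add: step_def)
next
  case (Suc r)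
  have "y (i, step (d i) r) ^ (q ^ k) = y (i, nat ((int (step (d i) r) + b) mod int (d i)))"
    using assms step_less[of i r] by (auto simp: W_set_def)
  thus ?case
    unfolding step_Suc Suc by (simp add: mult.commute flip: power_mult)
qed

lemma W_nonzero: "y \<in> W \<Longrightarrow> j < d i \<Longrightarrow> y (i, j) \<noteq> 0"
  by (force simp: W_set_def PiE_def Pi_def)

lemma W_0_fixed:
  assumes "y \<in> W"
  shows "y (i, 0) ^ ((q ^ k) ^ d i) = y (i, 0)"
  using W_step[OF assms, of i "d i"] by (simp add: step_def)

lemma W_0_fixed_D:
  assumes "y \<in> W"
  shows "y (i, 0) ^ ((q ^ k) ^ D) = y (i, 0)"
  using power_fixed_cong[OF W_0_fixed[OF assms, of i], of D 0] d_dvd_D[of i] by simp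

lemma W_fixed_D:
  assumes "y \<in> W" "j < d i"
  shows "y (i, j) ^ ((q ^ k) ^ D) = y (i, j)"
proof -
  have "y (i, j) = y (i, 0) ^ ((q ^ k) ^ (j * binv))"
    using W_step[OF assms(1), of i "j * binv"] step_binv[OF assms(2)] by simp
  thus ?thesis
    using W_0_fixed_D[OF assms(1), of i] by (metis power_mult mult.commute)
qed

text \<open>The inverse sends \<open>x\<close> to
  \<open>y (i, j) = x i ^ ((q ^ k) ^ (j * binv))\<close>, since the index \<open>j\<close> is
  reached from 0 after \<open>j * binv\<close> shifts.\<close>

lemma bij_betw_W:
  "bij_betw (\<lambda>y i. y (i, 0)) W {x :: 'n \<Rightarrow> 'r::field. \<forall>i. x i \<in> GF (q ^ (k * d i)) - {0}}"
proof (rule bij_betw_byWitness)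
  let ?X = "{x :: 'n \<Rightarrow> 'r. \<forall>i. x i \<in> GF (q ^ (k * d i)) - {0}}"
  let ?I = "SIGMA i:UNIV. {..<d i}"
  define inv where "inv x = restrict (\<lambda>(i, j). x i ^ ((q ^ k) ^ (j * binv))) ?I" for x :: "'n \<Rightarrow> 'r"
  have inv: "inv x (i, j) = x i ^ ((q ^ k) ^ (j * binv))" if "j < d i" for x i j
    using that by (simp add: inv_def)
  show "\<forall>y\<in>W. inv (\<lambda>i. y (i, 0)) = y"
  proof
    fix y :: "'n \<times> nat \<Rightarrow> 'r" assume y: "y \<in> W"
    show "inv (\<lambda>i. y (i, 0)) = y"
    proof
      fix ij
      show "inv (\<lambda>i. y (i, 0)) ij = y ij"
      proof (cases "ij \<in> ?I")
        case True
        thus ?thesis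
          using W_step[OF y] step_binv by (cases ij) (metis (no_types, lifting) SigmaE inv lessThan_iff prod.inject)
      next
        case False
        thus ?thesis
          using y by (cases ij) (auto simp: inv_def W_set_def PiE_def extensional_def)
      qed
    qed
  qed
  show "\<forall>x\<in>?X. (\<lambda>i. inv x (i, 0)) = x"
    using d_pos by (simp add: inv fun_eq_iff)
  show "(\<lambda>y i. y (i, 0)) ` W \<subseteq> ?X"
    using W_nonzero d_pos W_0_fixed by (auto simp: GF_def power_mult)
  show "inv ` ?X \<subseteq> W"
  proof clarify
    fix x :: "'n \<Rightarrow> 'r" assume x: "\<forall>i. x i \<in> GF (q ^ (k * d i)) - {0}"
    have "inv x (i, j) ^ (q ^ k) = inv x (i, nat ((int j + b) mod int (d i)))" if j: "j < d i" for i j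
    proof -
      define j' where "j' = nat ((int j + b) mod int (d i))"
      have j': "int j' = (int j + b) mod int (d i)" "j' < d i"
        using d_pos[of i] by (auto simp: j'_def nat_less_iff)
      \<comment> \<open>The exponent at \<open>j + b\<close> is one more than that at
        \<open>j\<close> modulo \<open>d i\<close>, because \<open>b * binv\<close> is 1 there; only
        this residue matters for a power of \<open>x i\<close>.\<close>
      have "int (j' * binv) mod int (d i) = ((int j + b) mod int (d i) * int binv) mod int (d i)"
        by (simp add: j')
      also have "\<dots> = ((int j + b) * int binv) mod int (d i)"
        by (rule mod_mult_left_eq)
      also have "\<dots> = (int j * int binv + int binv * b mod int (d i)) mod int (d i)"
        by (simp add: mod_add_right_eq algebra_simps)
      also have "\<dots> = int (Suc (j * binv)) mod int (d i)"
        by (simp add: binv_d mod_add_left_eq mod_add_right_eq add.commute)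
      finally have "(j' * binv) mod d i = Suc (j * binv) mod d i"
        by (metis of_nat_eq_iff zmod_int)
      moreover have "x i ^ ((q ^ k) ^ d i) = x i"
        using x by (simp add: GF_def power_mult)
      ultimately have "x i ^ ((q ^ k) ^ (j' * binv)) = x i ^ ((q ^ k) ^ Suc (j * binv))"
        by (intro power_fixed_cong)
      thus ?thesis
        using j j' by (simp add: inv j'_def[symmetric] mult.commute flip: power_mult)
    qed
    moreover have "inv x \<in> ?I \<rightarrow>\<^sub>E (UNIV - {0})"
      using x by (auto simp: inv_def)
    ultimately show "inv x \<in> W"
      by (auto simp: W_set_def)
  qed
qed

end

section \<open>Comparison of the summands and of the index sets\<close>

theorem theorem4p2:
  fixes p a q k :: nat and b :: int
    and red :: "'k::nonarch_closed_field \<Rightarrow> 'r::alg_closed_field"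
    and \<gamma> :: 'k and \<tau> :: "'k \<Rightarrow> 'k"
    and f :: "('n::finite, 'r) laurent" and d :: "'n \<Rightarrow> nat"
  assumes "prime p" and "a \<ge> 1" and "q = p ^ a"
    and "is_Cp p TYPE('k)" and "is_Fp_bar p TYPE('r)" and "is_residue_map red"
    and "is_dwork_root p \<gamma>"
    and "is_frobenius p q \<tau>"
    and "\<And>u. u \<in> Poly_Mapping.keys f \<Longrightarrow> Poly_Mapping.lookup f u \<in> GF q"
    and "\<And>i. d i \<ge> 1"
    and "k \<ge> 1"
    and "coprime b (int (Lcm (range d)))"
  shows "exp_sum p a red \<gamma> f d k =
    (\<Sum>y\<in>W_set q d k b. \<Prod>j<k. dwork_Fa p a red \<gamma> \<tau> f d (\<lambda>ij. teich p red (y ij) ^ (q ^ j)))"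
proof -
  interpret Dwork_Teich p "TYPE('k)" \<gamma> red
    by unfold_locales (use assms in \<open>auto simp: is_Cp_def\<close>)
  interpret twisted_torus q k b d
    by unfold_locales (use assms(10,12) in \<open>auto simp: Suc_le_eq\<close>)
  define U where "U = Poly_Mapping.keys f"
  define c where "c = Poly_Mapping.lookup f"
  define m where "m = a * k * D"
  have m: "m > 0"
    using assms D_pos by (simp add: m_def)
  have qk: "q ^ k = p ^ (a * k)" and qkD: "(q ^ k) ^ D = p ^ m"
    by (simp_all add: assms(3) m_def power_mult)
  have U: "finite U" by (simp add: U_def)
  have c: "c u ^ (p ^ a) = c u" if "u \<in> U" for u
    using assms(9)[of u] that by (simp add: GF_def U_def c_def assms(3))
  have c_m: "c u ^ (p ^ m) = c u" if "u \<in> U" for u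
    using power_fixed_cong[of "c u" p a m 0] c[OF that] by (simp add: m_def)
  have summand: "psi p a red \<gamma> (ff_trace (p ^ a) (k * D) (laurent_eval f (\<lambda>i. y (i, 0)))) =
        (\<Prod>j<k. dwork_Fa p a red \<gamma> \<tau> f d (\<lambda>ij. teich p red (y ij) ^ (q ^ j)))"
    if y: "y \<in> W" for y
  proof -
    \<comment> \<open>\<open>M u l\<close> is the term of \<open>f\<close> with exponent
      \<open>u\<close> at the point with coordinates \<open>y (i, l mod d i)\<close>; for
      \<open>l = 0\<close> this is the point \<open>x\<close> corresponding to
      \<open>y\<close>.\<close>
    define M where "M u l = c u * (\<Prod>i\<in>UNIV. y (i, l mod d i) powi u i)" for u l
    have y_m: "y (i, l mod d i) ^ (p ^ m) = y (i, l mod d i)" for i l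
      using W_fixed_D[OF y, of "l mod d i" i] d_pos[of i] by (simp add: qkD)
    have ypowi_m: "(y (i, l mod d i) powi n) ^ (p ^ m) = y (i, l mod d i) powi n" for i l n
      unfolding power_powi_commute[symmetric] y_m ..
    have prod_m: "(\<Prod>i\<in>UNIV. y (i, l mod d i) powi u i) ^ (p ^ m) =
                  (\<Prod>i\<in>UNIV. y (i, l mod d i) powi u i)" for u l
      unfolding prod_power_distrib ypowi_m ..
    have M_m: "M u l ^ (p ^ m) = M u l" if "u \<in> U" for u l
      using c_m[OF that] prod_m by (simp add: M_def power_mult_distrib)
    have teich_M: "teich p red (M u l) =
                     teich p red (c u) * (\<Prod>i\<in>UNIV. teich p red (y (i, l mod d i)) powi u i)"
      if "u \<in> U" for u l
      unfolding M_def
      using teich_mult[OF c_m[OF that] prod_m m] teich_powi[OF y_m m]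
        teich_prod[of UNIV "\<lambda>i. y (i, l mod d i) powi u i" m, OF ypowi_m m]
      by simp
    \<comment> \<open>The coefficient is fixed by the \<open>q\<close>-th power, so \<open>r\<close>
      shifts act on the whole term as the power \<open>q ^ (k * r)\<close>.\<close>
    have M_step: "M u (step D r) = M u 0 ^ (p ^ (a * k * r))" if "u \<in> U" for u r
    proof -
      have "c u ^ (p ^ (a * k * r)) = c u"
        using power_fixed_cong[of "c u" p a "a * k * r" 0] c[OF that] by simp
      moreover have "y (i, step D r mod d i) powi n = (y (i, 0) powi n) ^ (p ^ (a * k * r))" for i n
      proof -
        have "y (i, step D r mod d i) = y (i, 0) ^ (p ^ (a * k * r))"
          using W_step[OF y, of i r] by (simp add: step_D_mod qk flip: power_mult)
        thus ?thesis by (simp add: power_powi_commute)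
      qed
      ultimately show ?thesis
        by (simp add: M_def power_mult_distrib prod_power_distrib)
    qed
    have Fa: "dwork_Fa p a red \<gamma> \<tau> f d (\<lambda>ij. teich p red (y ij) ^ (q ^ j)) =
        (\<Prod>n<a. \<Prod>l<D. \<Prod>u\<in>U. theta p \<gamma> (teich p red (M u l) ^ (p ^ (a * j + n))))" for j
    proof -
      have "(\<tau> ^^ n) (teich p red (c u)) *
              (\<Prod>i\<in>UNIV. ((teich p red (y (i, l mod d i)) ^ (q ^ j)) ^ (p ^ n)) powi u i) =
            teich p red (M u l) ^ (p ^ (a * j + n))" if u: "u \<in> U" for u l n
      proof -
        have "(\<tau> ^^ n) (teich p red (c u)) = teich p red (c u) ^ (p ^ n)"
          using frobenius_teich[OF _ c[OF u]] assms by auto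
        \<comment> \<open>The lifted coefficient is fixed by the \<open>q\<close>-th power, so
          \<open>a * j\<close> may be added to match the exponent of the coordinates.\<close>
        also have "\<dots> = teich p red (c u) ^ (p ^ (a * j + n))"
          using teich_power_fixed[OF c[OF u]] assms by (intro power_fixed_cong[of _ p a]) auto
        finally have 1: "(\<tau> ^^ n) (teich p red (c u)) = teich p red (c u) ^ (p ^ (a * j + n))" .
        have "((w ^ (q ^ j)) ^ (p ^ n)) powi i = (w powi i) ^ (p ^ (a * j + n))" for w :: 'k and i
        proof -
          have "(w ^ (q ^ j)) ^ (p ^ n) = w ^ (p ^ (a * j + n))"
            by (simp add: assms(3) power_add flip: power_mult)
          thus ?thesis by (simp add: power_powi_commute)
        qed
        thus ?thesis
          by (simp add: 1 teich_M[OF u] power_mult_distrib prod_power_distrib)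
      qed
      thus ?thesis
        unfolding dwork_Fa_def dwork_F_def D_def[symmetric] U_def[symmetric] c_def[symmetric]
        by (intro prod.cong refl) auto
    qed
    have "(\<Prod>j<k. dwork_Fa p a red \<gamma> \<tau> f d (\<lambda>ij. teich p red (y ij) ^ (q ^ j))) =
          (\<Prod>e<a * k. \<Prod>l<D. \<Prod>u\<in>U. theta p \<gamma> (teich p red (M u l) ^ (p ^ e)))"
      unfolding Fa by (rule prod_lessThan_mult_group)
    \<comment> \<open>The index \<open>l\<close> becomes the position after \<open>r\<close> shifts
      by \<open>b\<close>, which makes every argument a power of the lifted term at
      \<open>l = 0\<close>.\<close>
    also have "\<dots> = (\<Prod>e<a * k. \<Prod>r<D. \<Prod>u\<in>U. theta p \<gamma> (teich p red (M u (step D r)) ^ (p ^ e)))"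
      by (intro prod.cong refl prod.reindex_bij_betw[OF bij_step_D, symmetric])
    also have "\<dots> = (\<Prod>e<a * k. \<Prod>r<D. \<Prod>u\<in>U. theta p \<gamma> (teich p red (M u 0) ^ (p ^ (a * k * r + e))))"
      by (intro prod.cong refl)
         (simp add: M_step teich_power[OF M_m m] power_add flip: power_mult)
    also have "\<dots> = (\<Prod>r<D. \<Prod>e<a * k. \<Prod>u\<in>U. theta p \<gamma> (teich p red (M u 0) ^ (p ^ (a * k * r + e))))"
      by (rule prod.swap)
    \<comment> \<open>The exponents \<open>a * k * r + e\<close> run once through all numbers below
      \<open>m\<close>, which are the Frobenius exponents in the trace to the prime field.\<close>
    also have "\<dots> = (\<Prod>e<m. \<Prod>u\<in>U. theta p \<gamma> (teich p red (M u 0) ^ (p ^ e)))"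
      unfolding m_def by (rule prod_lessThan_mult_group)
    also have "\<dots> = (\<Prod>u\<in>U. \<Prod>e<m. theta p \<gamma> (teich p red (M u 0) ^ (p ^ e)))"
      by (rule prod.swap)
    also have "\<dots> = Theta p red \<gamma> (ff_trace p m (\<Sum>u\<in>U. M u 0))"
      by (intro Theta_trace_sum[symmetric] U M_m m)
    also have "(\<Sum>u\<in>U. M u 0) = laurent_eval f (\<lambda>i. y (i, 0))"
      by (simp add: M_def laurent_eval_def U_def c_def)
    finally show ?thesis
      by (simp add: psi_def ff_trace_tower m_def mult.assoc)
  qed
  have "(\<Sum>y\<in>W. psi p a red \<gamma> (ff_trace (p ^ a) (k * D) (laurent_eval f (\<lambda>i. y (i, 0))))) =
        exp_sum p a red \<gamma> f d k"
    unfolding exp_sum_def D_def[symmetric] assms(3)[symmetric] power_mult[symmetric]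
    by (rule sum.reindex_bij_betw[OF bij_betw_W])
  thus ?thesis
    using summand by (simp cong: sum.cong)
qed

end
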